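(* Let $p$ be a prime and let $k$ and $i$ be positive integers such that either $k\leq p-2$, or $k=p-1$ and $i\geq 2$. Let $P$ be a $p^i$-central pro-$p$ group of height $k$ such that the torsion elements of $P$ form a finite $p$-group. Then, for all $j\geq 1$, $P/\Omega_j(P)$ is also a $p^i$-central pro-$p$ group of height $k$. Moreover, $$\Omega_j(P)=\{x\in P\mid x^{p^j}=1\}.$$
   Context: For a pro-$p$ group $P$ and $i\geq 0$, $\Omega_i(P)$ denotes the closed subgroup of $P$ topologically generated by the elements $x\in P$ with $x^{p^i}=1$. $\zeta_k(P)$ denotes the $k$-th term of the ascending (upper) central series of $P$, with $\zeta_1(P)=\mathrm{Z}(P)$. For $i,k\geq 1$, $P$ is called $p^i$-central of height $k$ if $\Omega_i(P)\leq\zeta_k(P)$. The hypothesis that the torsion elements form a finite $p$-group means that the set of all elements of finite order of $P$ is a finite subgroup of $P$. *)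

theory Defs
  imports
    "HOL-Analysis.Analysis"
    "HOL-Algebra.Generated_Groups"
    "HOL-Computational_Algebra.Primes"
begin

locale topological_group = group G for G :: "('a, 'b) monoid_scheme" (structure) +
  fixes T :: "'a topology"
  assumes topspace_eq: "topspace T = carrier G"
    and continuous_mult: "continuous_map (prod_topology T T) T (\<lambda>(x, y). x \<otimes> y)"
    and continuous_inv: "continuous_map T T (\<lambda>x. inv x)"

locale profinite_group = topological_group +
  assumes compact: "compact_space T"
    and Hausdorff: "Hausdorff_space T"
    and open_subgroup_base:
      "\<And>U. openin T U \<Longrightarrow> \<one> \<in> U \<Longrightarrow> \<exists>H. subgroup H G \<and> openin T H \<and> H \<subseteq> U"

(* Since card is 0 on infinite sets, the index condition includes finiteness of the index
   (for p > 0). *)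
locale pro_p_group = profinite_group +
  fixes p :: nat
  assumes open_normal_index:
    "\<And>N. N \<lhd> G \<Longrightarrow> openin T N \<Longrightarrow> \<exists>n. card (rcosets N) = p ^ n"

definition quotient_topology :: "'a topology \<Rightarrow> ('a \<Rightarrow> 'b) \<Rightarrow> 'b topology" where
  "quotient_topology T f =
     topology (\<lambda>U. U \<subseteq> f ` topspace T \<and> openin T {x \<in> topspace T. f x \<in> U})"

lemma openin_quotient_topology:
  "openin (quotient_topology T f) U \<longleftrightarrow>
     U \<subseteq> f ` topspace T \<and> openin T {x \<in> topspace T. f x \<in> U}"
proof -
  have "istopology (\<lambda>U. U \<subseteq> f ` topspace T \<and> openin T {x \<in> topspace T. f x \<in> U})"
    unfolding istopology_def
  proof (intro conjI allI impI)
    fix S R assume S: "S \<subseteq> f ` topspace T \<and> openin T {x \<in> topspace T. f x \<in> S}"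
      and R: "R \<subseteq> f ` topspace T \<and> openin T {x \<in> topspace T. f x \<in> R}"
    have "{x \<in> topspace T. f x \<in> S \<inter> R} =
        {x \<in> topspace T. f x \<in> S} \<inter> {x \<in> topspace T. f x \<in> R}" by auto
    then show "openin T {x \<in> topspace T. f x \<in> S \<inter> R}" using S R by auto
    show "S \<inter> R \<subseteq> f ` topspace T" using S by auto
  next
    fix K assume K: "\<forall>S\<in>K. S \<subseteq> f ` topspace T \<and> openin T {x \<in> topspace T. f x \<in> S}"
    have "{x \<in> topspace T. f x \<in> \<Union>K} = (\<Union>S\<in>K. {x \<in> topspace T. f x \<in> S})" by auto
    then show "openin T {x \<in> topspace T. f x \<in> \<Union>K}" using K by auto
    show "\<Union>K \<subseteq> f ` topspace T" using K by auto
  qed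
  then show ?thesis by (simp add: quotient_topology_def)
qed

lemma topspace_quotient_topology [simp]: "topspace (quotient_topology T f) = f ` topspace T"
proof (rule antisym)
  show "topspace (quotient_topology T f) \<subseteq> f ` topspace T"
    using openin_quotient_topology openin_topspace by metis
  have "{x \<in> topspace T. f x \<in> f ` topspace T} = topspace T" by auto
  then show "f ` topspace T \<subseteq> topspace (quotient_topology T f)"
    by (intro openin_subset) (simp add: openin_quotient_topology)
qed

lemma quotient_map_quotient_topology: "quotient_map T (quotient_topology T f) f"
  by (auto simp: quotient_map_def openin_quotient_topology)

definition coset_topology :: "('a, 'b) monoid_scheme \<Rightarrow> 'a topology \<Rightarrow> 'a set \<Rightarrow> 'a set topology" where
  "coset_topology G T N = quotient_topology T (\<lambda>x. N #>\<^bsub>G\<^esub> x)"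

definition center :: "('a, 'b) monoid_scheme \<Rightarrow> 'a set" where
  "center G = {z \<in> carrier G. \<forall>x \<in> carrier G. z \<otimes>\<^bsub>G\<^esub> x = x \<otimes>\<^bsub>G\<^esub> z}"

primrec upper_central_series :: "('a, 'b) monoid_scheme \<Rightarrow> nat \<Rightarrow> 'a set" where
  "upper_central_series G 0 = {\<one>\<^bsub>G\<^esub>}"
| "upper_central_series G (Suc k) =
     {x \<in> carrier G. upper_central_series G k #>\<^bsub>G\<^esub> x \<in> center (G Mod upper_central_series G k)}"

lemma (in group) upper_central_series_1: "upper_central_series G 1 = center G"
proof -
  have coset: "{\<one>} #> x = {x}" if "x \<in> carrier G" for x
    using that by (simp add: r_coset_def)
  show ?thesis
    by (auto simp: center_def carrier_FactGroup coset set_mult_def)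
qed

(* The closed subgroup generated by a set is the closure of the abstract subgroup it generates. *)
definition Omega :: "('a, 'b) monoid_scheme \<Rightarrow> 'a topology \<Rightarrow> nat \<Rightarrow> nat \<Rightarrow> 'a set" where
  "Omega G T p i =
     T closure_of generate G {x \<in> carrier G. x [^]\<^bsub>G\<^esub> (p ^ i) = \<one>\<^bsub>G\<^esub>}"

definition p_power_central ::
    "('a, 'b) monoid_scheme \<Rightarrow> 'a topology \<Rightarrow> nat \<Rightarrow> nat \<Rightarrow> nat \<Rightarrow> bool" where
  "p_power_central G T p i k \<longleftrightarrow> Omega G T p i \<subseteq> upper_central_series G k"

definition torsion_elements :: "('a, 'b) monoid_scheme \<Rightarrow> 'a set" where
  "torsion_elements G = {x \<in> carrier G. \<exists>n::nat. n > 0 \<and> x [^]\<^bsub>G\<^esub> n = \<one>\<^bsub>G\<^esub>}"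

definition finite_p_subgroup :: "('a, 'b) monoid_scheme \<Rightarrow> nat \<Rightarrow> 'a set \<Rightarrow> bool" where
  "finite_p_subgroup G p H \<longleftrightarrow> subgroup H G \<and> finite H \<and> (\<exists>n. card H = p ^ n)"

end

theory Submission
  imports Defs "HOL-Algebra.Group_Action"
begin

text \<open>Let \<open>X\<close> be the set of elements of order dividing \<open>p\<^sup>i\<^sup>+\<^sup>1\<close> and \<open>D\<^sub>n = [\<langle>X\<rangle>, P, \<dots>, P]\<close> with \<open>n\<close> factors \<open>P\<close>.
  Since \<open>p\<close>-th powers of elements of \<open>X\<close> lie in \<open>\<zeta>\<^sub>k(P)\<close>, a Hall--Petrescu argument gives
  \<open>(D\<^sub>n)\<^sup>p \<subseteq> D\<^sub>n\<^sub>+\<^sub>p\<^sub>-\<^sub>1\<close> for \<open>n \<ge> k\<close>. As the torsion subgroup is a finite normal \<open>p\<close>-subgroup, it lies in some \<open>\<zeta>\<^sub>N(P)\<close>, so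
  \<open>D\<^sub>n\<close> is eventually trivial; descending in \<open>n\<close>, the hypothesis on \<open>k\<close> and \<open>i\<close> forces \<open>(D\<^sub>n)\<^sup>p = 1\<close> down to
  \<open>n = k\<close>, that is, \<open>P/\<Omega>\<^sub>1(P)\<close> is again \<open>p\<^sup>i\<close>-central of height \<open>k\<close>. Applied to the elements
  of order \<open>p\<close> with \<open>0\<close> in place of \<open>k\<close>, the same inclusion shows that they form a subgroup. The
  general case follows by induction on \<open>j\<close>.\<close>

section \<open>Polynomial elements of a filtered group\<close>

definition com :: "('a, 'b) monoid_scheme \<Rightarrow> 'a \<Rightarrow> 'a \<Rightarrow> 'a" where
  "com G x y = x \<otimes>\<^bsub>G\<^esub> y \<otimes>\<^bsub>G\<^esub> inv\<^bsub>G\<^esub> x \<otimes>\<^bsub>G\<^esub> inv\<^bsub>G\<^esub> y"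

context group
begin

lemma com_closed [simp, intro]: "x \<in> carrier G \<Longrightarrow> y \<in> carrier G \<Longrightarrow> com G x y \<in> carrier G"
  by (simp add: com_def)

lemma inv_mult_cancel [simp]: "x \<in> carrier G \<Longrightarrow> y \<in> carrier G \<Longrightarrow> inv x \<otimes> (x \<otimes> y) = y"
  by (simp flip: m_assoc)

lemma mult_inv_cancel [simp]: "x \<in> carrier G \<Longrightarrow> y \<in> carrier G \<Longrightarrow> x \<otimes> (inv x \<otimes> y) = y"
  by (simp flip: m_assoc)

lemmas group_word_simps = com_def m_assoc inv_mult_group

text \<open>Meant for \<open>a\<close> and \<open>b\<close> the differences of \<open>f\<close> and
  \<open>g\<close>: the left side is then the shifted commutator, and the right side isolates
  \<open>com G f g\<close> from factors of higher degree.\<close>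

lemma com_mult:
  assumes "f \<in> carrier G" "a \<in> carrier G" "g \<in> carrier G" "b \<in> carrier G"
  shows "com G (f \<otimes> a) (g \<otimes> b) =
    f \<otimes> (com G a g \<otimes> (g \<otimes> com G a b \<otimes> inv g)) \<otimes> inv f \<otimes> com G f g \<otimes> (g \<otimes> com G f b \<otimes> inv g)"
  using assms by (simp add: group_word_simps)

lemma conj_eq_com: "x \<in> carrier G \<Longrightarrow> y \<in> carrier G \<Longrightarrow> x \<otimes> y \<otimes> inv x = com G x y \<otimes> y"
  by (simp add: group_word_simps)

lemma inv_com: "x \<in> carrier G \<Longrightarrow> y \<in> carrier G \<Longrightarrow> inv (com G x y) = com G y x"
  by (simp add: group_word_simps)

end

text \<open>The model is a group of sequences, with \<open>T\<close> the shift and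
  \<open>L j\<close> the sequences with values in the \<open>j\<close>-th term of a
  filtration.\<close>

locale filtered_group_endo = group \<Gamma> for \<Gamma> (structure) +
  fixes T :: "'a \<Rightarrow> 'a" and L :: "nat \<Rightarrow> 'a set"
  assumes T_hom: "T \<in> hom \<Gamma> \<Gamma>"
    and L_subgroup: "subgroup (L j) \<Gamma>"
    and L_T: "f \<in> L j \<Longrightarrow> T f \<in> L j"
    and L_Suc: "L (Suc j) \<subseteq> L j"
    and L_com: "f \<in> L i \<Longrightarrow> g \<in> L j \<Longrightarrow> com \<Gamma> f g \<in> L (i + j)"
begin

text \<open>Truncating the iterated differences \<open>f\<^sup>-\<^sup>1 T f\<close> at depth \<open>t\<close> makes the proof of the closure
  properties an induction: a difference of a product or a commutator involves only elements and
  differences for which depth \<open>t\<close> is already settled.\<close>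

fun poly :: "nat \<Rightarrow> nat \<Rightarrow> 'a set" where
  "poly 0 j = L j"
| "poly (Suc t) j = {f \<in> L j. inv f \<otimes> T f \<in> poly t (Suc j)}"

lemma L_carrier: "f \<in> L j \<Longrightarrow> f \<in> carrier \<Gamma>"
  using subgroup.mem_carrier[OF L_subgroup] .

lemma poly_L: "f \<in> poly t j \<Longrightarrow> f \<in> L j"
  by (cases t) auto

lemma poly_carrier: "f \<in> poly t j \<Longrightarrow> f \<in> carrier \<Gamma>"
  using poly_L L_carrier by blast

lemma T_closed: "f \<in> carrier \<Gamma> \<Longrightarrow> T f \<in> carrier \<Gamma>"
  using T_hom by (auto simp: hom_def)

lemma T_mult: "f \<in> carrier \<Gamma> \<Longrightarrow> g \<in> carrier \<Gamma> \<Longrightarrow> T (f \<otimes> g) = T f \<otimes> T g"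
  using T_hom by (auto simp: hom_def)

lemma T_inv: "f \<in> carrier \<Gamma> \<Longrightarrow> T (inv f) = inv (T f)"
  by (metis T_hom group_axioms group_hom.hom_inv group_hom.intro group_hom_axioms.intro)

lemma T_one: "T \<one> = \<one>"
  by (metis T_hom group_axioms hom_one)

lemma T_com: "f \<in> carrier \<Gamma> \<Longrightarrow> g \<in> carrier \<Gamma> \<Longrightarrow> T (com \<Gamma> f g) = com \<Gamma> (T f) (T g)"
  by (simp add: com_def T_mult T_inv T_closed)

lemma poly_Suc_t: "poly (Suc t) j \<subseteq> poly t j"
proof (induction t arbitrary: j)
  case 0
  then show ?case by auto
next
  case (Suc t)
  then show ?case by (auto simp del: poly.simps(2) simp: poly.simps(2)[of "Suc t"] poly.simps(2)[of t])
qed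

text \<open>The Lazard-Leibman theorem that polynomial sequences form a group. The claims are proved
  together, since closure under products and inverses at each depth uses the commutator claim one
  depth below.\<close>

lemma poly_properties:
  "subgroup (poly t j) \<Gamma> \<and> poly t (Suc j) \<subseteq> poly t j \<and>
   (\<forall>i. \<forall>f\<in>poly t i. \<forall>g\<in>poly t j. com \<Gamma> f g \<in> poly t (i + j))"
proof (induction t arbitrary: j)
  case 0
  then show ?case using L_subgroup L_Suc L_com by auto
next
  case (Suc t)
  have sub: "subgroup (poly t j) \<Gamma>" for j using Suc by blast
  have dec: "poly t (Suc j) \<subseteq> poly t j" for j using Suc by blast
  have com: "com \<Gamma> f g \<in> poly t (i + j)" if "f \<in> poly t i" "g \<in> poly t j" for f g i j
    using Suc that by blast
  have dec': "poly t j \<subseteq> poly t 0" for j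
    by (induction j) (use dec in auto)
  \<comment> \<open>A conjugate is a commutator times the element, and the conjugator contributes
    degree 0; so \<open>poly t 0\<close> normalises every \<open>poly t j\<close>.\<close>
  have norm: "x \<otimes> k \<otimes> inv x \<in> poly t j" if "x \<in> poly t 0" "k \<in> poly t j" for x k j
    using com[OF that] that conj_eq_com[of x k] poly_carrier subgroup.m_closed[OF sub]
    by auto
  have norm': "inv x \<otimes> k \<otimes> x \<in> poly t j" if "x \<in> poly t 0" "k \<in> poly t j" for x k j
    using norm[of "inv x" k j] that subgroup.m_inv_closed[OF sub] poly_carrier by fastforce
  have up: "f \<in> poly t j" if "f \<in> poly (Suc t) j" for f j
    using that poly_Suc_t by blast
  have up0: "f \<in> poly t 0" if "f \<in> poly (Suc t) j" for f j
    using up[OF that] dec' by blast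
  have "subgroup (poly (Suc t) j) \<Gamma>"
  proof (rule subgroupI)
    show "poly (Suc t) j \<subseteq> carrier \<Gamma>" using poly_carrier by blast
    have "\<one> \<in> poly (Suc t) j"
      using subgroup.one_closed[OF L_subgroup] subgroup.one_closed[OF sub] by (simp add: T_one)
    then show "poly (Suc t) j \<noteq> {}" by blast
  next
    fix f assume f: "f \<in> poly (Suc t) j"
    then have fc: "f \<in> carrier \<Gamma>" using poly_carrier by blast
    have "f \<otimes> inv (inv f \<otimes> T f) \<otimes> inv f \<in> poly t (Suc j)"
      using norm[OF up0[OF f] subgroup.m_inv_closed[OF sub]] f by simp
    also have "f \<otimes> inv (inv f \<otimes> T f) \<otimes> inv f = inv (inv f) \<otimes> T (inv f)"
      using fc by (simp add: group_word_simps T_inv T_closed)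
    finally show "inv f \<in> poly (Suc t) j"
      using f subgroup.m_inv_closed[OF L_subgroup] by auto
  next
    fix f g assume f: "f \<in> poly (Suc t) j" and g: "g \<in> poly (Suc t) j"
    then have c: "f \<in> carrier \<Gamma>" "g \<in> carrier \<Gamma>" using poly_carrier by blast+
    have "inv g \<otimes> (inv f \<otimes> T f) \<otimes> g \<otimes> (inv g \<otimes> T g) \<in> poly t (Suc j)"
      using subgroup.m_closed[OF sub norm'[OF up0[OF g]]] f g by simp
    also have "inv g \<otimes> (inv f \<otimes> T f) \<otimes> g \<otimes> (inv g \<otimes> T g) = inv (f \<otimes> g) \<otimes> T (f \<otimes> g)"
      using c by (simp add: group_word_simps T_mult T_closed)
    finally show "f \<otimes> g \<in> poly (Suc t) j"
      using f g subgroup.m_closed[OF L_subgroup] by auto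
  qed
  moreover have "poly (Suc t) (Suc j) \<subseteq> poly (Suc t) j"
    using L_Suc dec by auto
  moreover have "com \<Gamma> f g \<in> poly (Suc t) (i + j)" if f: "f \<in> poly (Suc t) i" and g: "g \<in> poly (Suc t) j"
    for i f g
  proof -
    let ?a = "inv f \<otimes> T f" and ?b = "inv g \<otimes> T g" and ?K = "poly t (Suc (i + j))"
    have c: "f \<in> carrier \<Gamma>" "g \<in> carrier \<Gamma>" using poly_carrier f g by blast+
    have a: "?a \<in> poly t (Suc i)" and b: "?b \<in> poly t (Suc j)" using f g by auto
    note K = subgroup.m_closed[OF sub]
    have ag: "com \<Gamma> ?a g \<in> ?K" using com[OF a up[OF g]] by simp
    have fb: "com \<Gamma> f ?b \<in> ?K" using com[OF up[OF f] b] by simp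
    have ab: "com \<Gamma> ?a ?b \<in> ?K" using com[OF a b] dec by auto
    let ?u = "f \<otimes> (com \<Gamma> ?a g \<otimes> (g \<otimes> com \<Gamma> ?a ?b \<otimes> inv g)) \<otimes> inv f"
      and ?v = "g \<otimes> com \<Gamma> f ?b \<otimes> inv g"
    have u: "?u \<in> ?K" and v: "?v \<in> ?K"
      using norm[OF up0[OF f] K[OF ag norm[OF up0[OF g] ab]]] norm[OF up0[OF g] fb] by blast+
    have c0: "com \<Gamma> f g \<in> poly t 0"
      using com[OF up0[OF f] up0[OF g]] by simp
    \<comment> \<open>By \<open>com_mult\<close>, \<open>T (com \<Gamma> f g)\<close> is
      \<open>?u\<close> times \<open>com \<Gamma> f g\<close> times \<open>?v\<close>. Moving
      \<open>?u\<close> past the commutator conjugates it by an element of degree 0, which keeps it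
      in \<open>?K\<close>.\<close>
    have "inv (com \<Gamma> f g) \<otimes> ?u \<otimes> com \<Gamma> f g \<otimes> ?v \<in> ?K"
      using K[OF norm'[OF c0 u] v] .
    also have "inv (com \<Gamma> f g) \<otimes> ?u \<otimes> com \<Gamma> f g \<otimes> ?v = inv (com \<Gamma> f g) \<otimes> com \<Gamma> (f \<otimes> ?a) (g \<otimes> ?b)"
      using c T_closed[OF c(1)] T_closed[OF c(2)] poly_carrier[OF u] poly_carrier[OF v]
      by (subst com_mult) (auto simp: m_assoc)
    also have "com \<Gamma> (f \<otimes> ?a) (g \<otimes> ?b) = T (com \<Gamma> f g)"
      using c by (simp add: T_com T_closed)
    finally show ?thesis
      using f g L_com by simp
  qed
  ultimately show ?case by blast
qed

lemma poly_subgroup: "subgroup (poly t j) \<Gamma>"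
  using poly_properties by blast

end

section \<open>Products of prime powers\<close>

definition seq_group :: "('a, 'b) monoid_scheme \<Rightarrow> (nat \<Rightarrow> 'a) monoid" where
  "seq_group G = \<lparr>carrier = {f. \<forall>n. f n \<in> carrier G}, monoid.mult = (\<lambda>f g n. f n \<otimes>\<^bsub>G\<^esub> g n),
     one = (\<lambda>_. \<one>\<^bsub>G\<^esub>)\<rparr>"

context group
begin

lemma seq_group_simps [simp]:
  "f \<in> carrier (seq_group G) \<longleftrightarrow> (\<forall>n. f n \<in> carrier G)"
  "f \<otimes>\<^bsub>seq_group G\<^esub> g = (\<lambda>n. f n \<otimes> g n)"
  "\<one>\<^bsub>seq_group G\<^esub> = (\<lambda>_. \<one>)"
  by (simp_all add: seq_group_def)

lemma group_seq_group: "group (seq_group G)"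
proof (rule groupI)
  fix f assume "f \<in> carrier (seq_group G)"
  then show "\<exists>g\<in>carrier (seq_group G). g \<otimes>\<^bsub>seq_group G\<^esub> f = \<one>\<^bsub>seq_group G\<^esub>"
    by (intro bexI[of _ "\<lambda>n. inv f n"]) auto
qed (auto simp: m_assoc)

lemma inv_seq_group: "f \<in> carrier (seq_group G) \<Longrightarrow> inv\<^bsub>seq_group G\<^esub> f = (\<lambda>n. inv f n)"
  by (rule group.inv_equality[OF group_seq_group]) auto

lemma com_seq_group:
  "f \<in> carrier (seq_group G) \<Longrightarrow> g \<in> carrier (seq_group G) \<Longrightarrow>
    com (seq_group G) f g = (\<lambda>n. com G (f n) (g n))"
  by (simp add: com_def inv_seq_group)

lemma subgroup_nat_pow_closed: "subgroup H G \<Longrightarrow> x \<in> H \<Longrightarrow> x [^] (n::nat) \<in> H"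
  by (induction n) (auto simp: subgroup.one_closed subgroup.m_closed)

end

text \<open>An N-series numbered from 0: after shifting the index by one, commutators add degrees.
  The intended instances are the tails of \<open>rel_lcs\<close>.\<close>

locale strong_filtration = group +
  fixes N :: "nat \<Rightarrow> 'a set"
  assumes N_normal: "N j \<lhd> G"
    and N_com_carrier: "x \<in> N j \<Longrightarrow> g \<in> carrier G \<Longrightarrow> com G x g \<in> N (Suc j)"
    and N_com: "x \<in> N i \<Longrightarrow> y \<in> N j \<Longrightarrow> com G x y \<in> N (Suc (i + j))"
    and N_Suc: "N (Suc j) \<subseteq> N j"
begin

lemma N_subgroup: "subgroup (N j) G"
  using N_normal normal_imp_subgroup by blast

lemma N_carrier: "x \<in> N j \<Longrightarrow> x \<in> carrier G"
  using subgroup.mem_carrier[OF N_subgroup] .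

text \<open>The index shift \<open>0, 0, 1, 2, \<dots>\<close> uses truncated subtraction on purpose: a product of conjugates
  \<open>y\<^bsup>x\<^esup>\<close> has one degree more than its factors, and
  \<open>N_com\<close> leaves exactly one index to spare for this.\<close>

definition M :: "nat \<Rightarrow> 'a set" where "M j = N (j - 1)"

lemma M_simps [simp]: "M 0 = N 0" "M (Suc j) = N j"
  by (simp_all add: M_def)

lemma M_antimono: "i \<le> j \<Longrightarrow> M j \<subseteq> M i"
  unfolding M_def by (rule lift_Suc_antimono_le[of N]) (use N_Suc in auto)

lemma M_com: "x \<in> M i \<Longrightarrow> y \<in> M j \<Longrightarrow> com G x y \<in> M (i + j)"
proof -
  assume x: "x \<in> M i" and y: "y \<in> M j"
  have "com G x y \<in> N (Suc ((i - 1) + (j - 1)))"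
    using N_com x y unfolding M_def by blast
  then have "com G x y \<in> M (Suc (Suc ((i - 1) + (j - 1))))"
    by (simp add: M_def)
  moreover have "i + j \<le> Suc (Suc ((i - 1) + (j - 1)))" by arith
  ultimately show ?thesis using M_antimono by blast
qed

sublocale seq: filtered_group_endo "seq_group G" "\<lambda>f n. f (Suc n)" "\<lambda>j. {f. \<forall>n. f n \<in> M j}"
proof -
  interpret S: group "seq_group G" by (rule group_seq_group)
  have sub: "subgroup (M j) G" for j by (simp add: M_def N_subgroup)
  note c = subgroup.mem_carrier[OF sub]
  show "filtered_group_endo (seq_group G) (\<lambda>f n. f (Suc n)) (\<lambda>j. {f. \<forall>n. f n \<in> M j})"
  proof (intro filtered_group_endo.intro filtered_group_endo_axioms.intro S.group_axioms)
    show "(\<lambda>f n. f (Suc n)) \<in> hom (seq_group G) (seq_group G)"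
      by (auto simp: hom_def)
    show "subgroup {f. \<forall>n. f n \<in> M j} (seq_group G)" for j
    proof (rule S.subgroupI)
      have "(\<lambda>_::nat. \<one>) \<in> {f. \<forall>n. f n \<in> M j}"
        using subgroup.one_closed[OF sub] by auto
      then show "{f::nat \<Rightarrow> 'a. \<forall>n. f n \<in> M j} \<noteq> {}" by (metis empty_iff)
      show "{f. \<forall>n. f n \<in> M j} \<subseteq> carrier (seq_group G)"
        using c by fastforce
      show "inv\<^bsub>seq_group G\<^esub> f \<in> {f. \<forall>n. f n \<in> M j}" if "f \<in> {f. \<forall>n. f n \<in> M j}" for f
      proof -
        have "f \<in> carrier (seq_group G)" using that c by fastforce
        then show ?thesis using that subgroup.m_inv_closed[OF sub] by (simp add: inv_seq_group)
      qed
    qed (auto simp: subgroup.m_closed[OF sub])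
    show "{f. \<forall>n. f n \<in> M (Suc j)} \<subseteq> {f. \<forall>n. f n \<in> M j}" for j
      using M_antimono[of j "Suc j"] by auto
    show "com (seq_group G) f g \<in> {f. \<forall>n. f n \<in> M (i + j)}"
      if "f \<in> {f. \<forall>n. f n \<in> M i}" "g \<in> {f. \<forall>n. f n \<in> M j}" for f g i j
      using that by (subst com_seq_group) (auto intro: c M_com)
  qed auto
qed

lemma M_carrier: "x \<in> M j \<Longrightarrow> x \<in> carrier G"
  using N_carrier by (simp add: M_def)

lemma seq_poly_Suc:
  "f \<in> seq.poly (Suc t) j \<longleftrightarrow> (\<forall>n. f n \<in> M j) \<and> (\<lambda>n. inv f n \<otimes> f (Suc n)) \<in> seq.poly t (Suc j)"
proof -
  have "inv\<^bsub>seq_group G\<^esub> f = (\<lambda>n. inv f n)" if "\<forall>n. f n \<in> M j"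
    using that by (intro inv_seq_group) (auto intro: M_carrier)
  then show ?thesis by auto
qed

text \<open>If \<open>f\<close> is trivial below \<open>j\<close>, its \<open>j\<close>-th iterated
  difference at 0 is \<open>f j\<close>, and every difference raises the degree by one.\<close>

lemma seq_poly_value:
  assumes "f \<in> seq.poly t i" "\<And>n. n < j \<Longrightarrow> f n = \<one>" "j \<le> t"
  shows "f j \<in> M (i + j)"
  using assms
proof (induction j arbitrary: f t i)
  case 0
  then show ?case using seq.poly_L by fastforce
next
  case (Suc j)
  then obtain t' where t: "t = Suc t'" by (cases t) auto
  let ?d = "\<lambda>n. inv f n \<otimes> f (Suc n)"
  have f: "\<forall>n. f n \<in> M i" and d: "?d \<in> seq.poly t' (Suc i)"
    using Suc.prems(1) unfolding t seq_poly_Suc by auto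
  have "?d j \<in> M (Suc i + j)"
    using Suc.prems by (intro Suc.IH[OF d]) (auto simp: t)
  then show ?case
    using Suc.prems(2)[of j] M_carrier[OF f[rule_format, of "Suc j"]] by simp
qed

lemma M_pow_closed: "z \<in> M j \<Longrightarrow> z [^] (n::nat) \<in> M j"
  unfolding M_def by (rule subgroup_nat_pow_closed[OF N_subgroup])

text \<open>By Pascal's rule, taking the difference lowers \<open>j\<close> by one while the degree
  \<open>i\<close> rises by one. The sum \<open>i + j\<close> is thus preserved until
  \<open>j = 0\<close>, where the sequence is constant.\<close>

lemma seq_poly_power:
  assumes "z \<in> M (i + j)"
  shows "(\<lambda>n. z [^] (n choose j)) \<in> seq.poly t i"
  using assms
proof (induction t arbitrary: i j)
  case (0 i j)
  then have "z \<in> M i" using M_antimono[of i "i + j"] by auto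
  then show ?case
    using M_pow_closed by auto
next
  case (Suc t i j)
  note z = M_carrier[OF Suc.prems]
  have "z \<in> M i" using Suc.prems M_antimono[of i "i + j"] by auto
  then have *: "\<forall>n. z [^] (n choose j) \<in> M i"
    using M_pow_closed by auto
  show ?case
  proof (cases j)
    case 0
    have "\<one>\<^bsub>seq_group G\<^esub> \<in> seq.poly t (Suc i)"
      by (rule subgroup.one_closed[OF seq.poly_subgroup])
    then show ?thesis
      using * 0 z unfolding seq_poly_Suc by simp
  next
    case (Suc j')
    have "inv (z [^] (n choose j)) \<otimes> z [^] (Suc n choose j) = z [^] (n choose j')" for n
    proof -
      have "z [^] (Suc n choose j) = z [^] (n choose j) \<otimes> z [^] (n choose j')"
        using z by (simp add: Suc nat_pow_mult add.commute)
      then show ?thesis using z by simp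
    qed
    moreover have "(\<lambda>n. z [^] (n choose j')) \<in> seq.poly t (Suc i)"
      using Suc.prems Suc by (intro Suc.IH) simp
    ultimately show ?thesis
      using * unfolding seq_poly_Suc by simp
  qed
qed

text \<open>One step of a Newton expansion: the binomial power of \<open>f j\<close> is trivial
  before \<open>j\<close> and equals \<open>f j\<close> at \<open>j\<close>, so dividing it off
  lengthens the initial run of trivial values and keeps the sequence polynomial.\<close>

lemma seq_poly_peel:
  assumes "f \<in> seq.poly t 0" "\<And>n. n < j \<Longrightarrow> f n = \<one>" "j \<le> t"
  shows "f j \<in> M j" "(\<lambda>n. inv (f j [^] (n choose j)) \<otimes> f n) \<in> seq.poly t 0"
    "\<And>n. n \<le> j \<Longrightarrow> inv (f j [^] (n choose j)) \<otimes> f n = \<one>"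
proof -
  show fj: "f j \<in> M j" using seq_poly_value[OF assms] by simp
  note poly = seq_poly_power[of "f j" 0 j t, simplified, OF fj]
  note Qs = subgroup.m_closed[OF seq.poly_subgroup subgroup.m_inv_closed[OF seq.poly_subgroup poly] assms(1)]
  show "(\<lambda>n. inv (f j [^] (n choose j)) \<otimes> f n) \<in> seq.poly t 0"
    using Qs M_carrier[OF fj] by (simp add: inv_seq_group)
  show "inv (f j [^] (n choose j)) \<otimes> f n = \<one>" if "n \<le> j" for n
    using that assms(2)[of n] M_carrier[OF fj] by (cases "n = j") (auto simp: binomial_eq_0)
qed

text \<open>Repeated peeling writes \<open>f p\<close> as a product of binomial powers. For
  \<open>2 \<le> j < p\<close> the prime divides the binomial coefficient and the base lies in
  \<open>M 2 = N 1\<close>; the last factor lies in \<open>M p = N (p - 1)\<close>.\<close>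

lemma seq_poly_prime:
  assumes p: "prime p" and K: "subgroup K G"
    and pow: "\<And>z. z \<in> N 1 \<Longrightarrow> z [^] p \<in> K" and NK: "N (p - 1) \<subseteq> K"
    and "f \<in> seq.poly p 0" "\<And>n. n < j \<Longrightarrow> f n = \<one>" "2 \<le> j" "j \<le> p"
  shows "f p \<in> K"
  using assms(5-8)
proof (induction "p - j" arbitrary: f j)
  case 0
  then have "f p \<in> M p" using seq_poly_peel(1)[of f p j] by auto
  then show ?case using NK by (auto simp: M_def)
next
  case (Suc d)
  let ?g = "\<lambda>n. inv (f j [^] (n choose j)) \<otimes> f n"
  note peel = seq_poly_peel[OF Suc.prems(1,2,4)]
  have "?g p \<in> K"
    using Suc.prems Suc.hyps(2) peel by (intro Suc.hyps(1)[of "Suc j"]) auto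
  have fj: "f j \<in> N 1"
    using peel(1) M_antimono[of 2 j] Suc.prems(3) by (auto simp: M_def numeral_2_eq_2)
  have "p dvd (p choose j)"
    using Suc.prems Suc.hyps(2) p by (intro dvd_choose_prime) auto
  then obtain r where r: "p choose j = p * r" by blast
  have "f j [^] (p choose j) \<in> K"
    unfolding r using nat_pow_pow[OF N_carrier[OF fj], of p r]
      subgroup_nat_pow_closed[OF K pow[OF fj], of r] by metis
  moreover have "f p = f j [^] (p choose j) \<otimes> ?g p"
    using N_carrier[OF fj] seq.poly_carrier[OF Suc.prems(1)] by simp
  ultimately show ?case
    using \<open>?g p \<in> K\<close> subgroup.m_closed[OF K] by metis
qed

text \<open>The difference of the sequence of conjugates of \<open>z\<close> is the sequence of
  conjugates of \<open>com G (inv z) x\<close>, which lies one step deeper. In the numbering of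
  \<open>M\<close>, \<open>N j\<close> has degree \<open>Suc j\<close>.\<close>

lemma seq_poly_conj:
  assumes "z \<in> N j" "x \<in> carrier G"
  shows "(\<lambda>n. x [^] (n::nat) \<otimes> z \<otimes> inv (x [^] n)) \<in> seq.poly t (Suc j)"
  using assms(1)
proof (induction t arbitrary: z j)
  case 0
  then show ?case
    using normal.inv_op_closed2[OF N_normal] assms(2) by simp
next
  case (Suc t)
  note z = N_carrier[OF Suc.prems]
  have "com G (inv z) x \<in> N (Suc j)"
    using N_com_carrier subgroup.m_inv_closed[OF N_subgroup] Suc.prems assms(2) by blast
  then have "(\<lambda>n. x [^] (n::nat) \<otimes> com G (inv z) x \<otimes> inv (x [^] n)) \<in> seq.poly t (Suc (Suc j))"
    by (rule Suc.IH)
  moreover have "inv (x [^] n \<otimes> z \<otimes> inv (x [^] n)) \<otimes> (x [^] Suc n \<otimes> z \<otimes> inv (x [^] Suc n)) =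
      x [^] n \<otimes> com G (inv z) x \<otimes> inv (x [^] n)" for n :: nat
    using z assms(2) by (simp add: group_word_simps)
  ultimately show ?case
    using normal.inv_op_closed2[OF N_normal] assms(2) Suc.prems
    unfolding seq_poly_Suc by simp
qed

text \<open>The sequence \<open>n \<mapsto> (y x)\<^sup>n x\<^sup>-\<^sup>n\<close> is polynomial, hence equals
  \<open>y\<^sup>n\<close> times powers of elements of \<open>N (j - 1)\<close> with exponents \<open>n choose j\<close>, \<open>j \<ge> 2\<close>. At \<open>n = p\<close> the
  exponents with \<open>j < p\<close> are divisible by \<open>p\<close>.\<close>

theorem mult_pow_prime:
  assumes p: "prime p" and K: "subgroup K G"
    and pow: "\<And>z. z \<in> N 1 \<Longrightarrow> z [^] p \<in> K" and NK: "N (p - 1) \<subseteq> K"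
    and y: "y \<in> N 0" and x: "x \<in> carrier G"
  shows "inv (y [^] p) \<otimes> ((y \<otimes> x) [^] p \<otimes> inv (x [^] p)) \<in> K"
proof -
  define s where "s = (\<lambda>n::nat. (y \<otimes> x) [^] n \<otimes> inv (x [^] n))"
  note yc = N_carrier[OF y]
  have d: "inv (s n) \<otimes> s (Suc n) = x [^] n \<otimes> y \<otimes> inv (x [^] n)" for n
    using x yc by (simp add: s_def group_word_simps)
  have s_Suc: "s (Suc n) = s n \<otimes> (x [^] n \<otimes> y \<otimes> inv (x [^] n))" for n
    using x yc unfolding d[symmetric] by (simp add: s_def)
  have "s n \<in> N 0" for n
  proof (induction n)
    case 0
    then show ?case using subgroup.one_closed[OF N_subgroup] by (simp add: s_def)
  next
    case (Suc n)
    then show ?case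
      unfolding s_Suc
      using x y normal.inv_op_closed2[OF N_normal] subgroup.m_closed[OF N_subgroup] by simp
  qed
  then have "s \<in> seq.poly (Suc p) 0"
    using seq_poly_conj[OF y x, of p] unfolding seq_poly_Suc d by simp
  then have sQ: "s \<in> seq.poly p 0" using seq.poly_Suc_t by blast
  have s01: "s 0 = \<one>" "s 1 = y" using x yc by (auto simp: s_def m_assoc)
  have "1 \<le> p" using p prime_ge_1_nat by blast
  note peel = seq_poly_peel[OF sQ _ this]
  have s0: "s n = \<one>" if "n < 1" for n using that s01 by simp
  \<comment> \<open>The degree-one factor \<open>y\<close> lies only in \<open>N 0\<close>, where
    nothing is assumed about \<open>p\<close>-th powers; it is peeled off first and stays in the
    conclusion.\<close>
  have "inv (s 1 [^] (p choose 1)) \<otimes> s p \<in> K"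
    using p prime_ge_2_nat[OF p]
    by (intro seq_poly_prime[OF p K pow NK peel(2), of 2] peel(3) s0) auto
  then show ?thesis unfolding s01 by (simp add: s_def)
qed

end

section \<open>Relative central series\<close>

text \<open>Upper and lower central series modulo a normal subgroup \<open>H\<close>, defined inside \<open>G\<close> so that the
  induction over the subgroups \<open>\<Omega>\<^sub>j\<close> does not change the type of the ambient group.\<close>

primrec rel_ucs :: "('a, 'b) monoid_scheme \<Rightarrow> 'a set \<Rightarrow> nat \<Rightarrow> 'a set" where
  "rel_ucs G H 0 = H"
| "rel_ucs G H (Suc j) = {x \<in> carrier G. \<forall>g\<in>carrier G. com G x g \<in> rel_ucs G H j}"

primrec rel_lcs :: "('a, 'b) monoid_scheme \<Rightarrow> 'a set \<Rightarrow> 'a set \<Rightarrow> nat \<Rightarrow> 'a set" where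
  "rel_lcs G H X 0 = generate G (X \<union> H)"
| "rel_lcs G H X (Suc m) =
     generate G ({com G d g | d g. d \<in> rel_lcs G H X m \<and> g \<in> carrier G} \<union> H)"

declare rel_lcs.simps [simp del]

context group
begin

lemma normal_conj: "H \<lhd> G \<Longrightarrow> x \<in> carrier G \<Longrightarrow> h \<in> H \<Longrightarrow> x \<otimes> h \<otimes> inv x \<in> H"
  by (rule normal.inv_op_closed2)

lemma normal_com_left: "H \<lhd> G \<Longrightarrow> x \<in> H \<Longrightarrow> g \<in> carrier G \<Longrightarrow> com G x g \<in> H"
proof -
  assume H: "H \<lhd> G" and x: "x \<in> H" and g: "g \<in> carrier G"
  have sub: "subgroup H G" using H by (rule normal_imp_subgroup)
  have "x \<otimes> (g \<otimes> inv x \<otimes> inv g) \<in> H"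
    using subgroup.m_closed[OF sub x normal_conj[OF H g subgroup.m_inv_closed[OF sub x]]] .
  then show ?thesis
    using subgroup.mem_carrier[OF sub x] g by (simp add: group_word_simps)
qed

lemma normal_com_right: "H \<lhd> G \<Longrightarrow> x \<in> H \<Longrightarrow> g \<in> carrier G \<Longrightarrow> com G g x \<in> H"
  using normal_com_left inv_com normal_imp_subgroup subgroup.mem_carrier subgroup.m_inv_closed
  by metis

lemma rel_ucs_normal:
  assumes "H \<lhd> G"
  shows "rel_ucs G H j \<lhd> G"
proof (induction j)
  case 0
  then show ?case using assms by simp
next
  case (Suc j)
  let ?Z = "rel_ucs G H j"
  have sub: "subgroup ?Z G" using Suc by (rule normal_imp_subgroup)
  note conj = normal_conj[OF Suc]
  have "subgroup (rel_ucs G H (Suc j)) G"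
  proof (rule subgroupI)
    show "rel_ucs G H (Suc j) \<subseteq> carrier G" by auto
    have "\<one> \<in> rel_ucs G H (Suc j)"
      using subgroup.one_closed[OF sub] by (auto simp: com_def)
    then show "rel_ucs G H (Suc j) \<noteq> {}" by blast
  next
    fix x assume x: "x \<in> rel_ucs G H (Suc j)"
    have "com G (inv x) g \<in> ?Z" if g: "g \<in> carrier G" for g
    proof -
      have "inv x \<otimes> inv (com G x g) \<otimes> inv (inv x) \<in> ?Z"
        using x g by (intro conj subgroup.m_inv_closed[OF sub]) auto
      then show ?thesis using x g by (simp add: group_word_simps)
    qed
    then show "inv x \<in> rel_ucs G H (Suc j)" using x by auto
  next
    fix x y assume x: "x \<in> rel_ucs G H (Suc j)" and y: "y \<in> rel_ucs G H (Suc j)"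
    have "com G (x \<otimes> y) g \<in> ?Z" if g: "g \<in> carrier G" for g
    proof -
      have "(x \<otimes> com G y g \<otimes> inv x) \<otimes> com G x g \<in> ?Z"
        using x y g by (intro subgroup.m_closed[OF sub] conj) auto
      then show ?thesis using x y g by (simp add: group_word_simps)
    qed
    then show "x \<otimes> y \<in> rel_ucs G H (Suc j)" using x y by auto
  qed
  moreover have "h \<otimes> x \<otimes> inv h \<in> rel_ucs G H (Suc j)"
    if h: "h \<in> carrier G" and x: "x \<in> rel_ucs G H (Suc j)" for h x
  proof -
    have "com G (h \<otimes> x \<otimes> inv h) g \<in> ?Z" if g: "g \<in> carrier G" for g
    proof -
      have "h \<otimes> com G x (inv h \<otimes> g \<otimes> h) \<otimes> inv h \<in> ?Z"
        using x g h by (intro conj) auto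
      then show ?thesis using x g h by (simp add: group_word_simps)
    qed
    then show ?thesis using x h by auto
  qed
  ultimately show ?case by (simp add: normal_inv_iff)
qed

lemma rel_ucs_subgroup: "H \<lhd> G \<Longrightarrow> subgroup (rel_ucs G H j) G"
  using rel_ucs_normal normal_imp_subgroup by blast

lemma rel_ucs_antimono:
  assumes H: "H \<lhd> G" and "i \<le> j"
  shows "rel_ucs G H i \<subseteq> rel_ucs G H j"
proof (rule lift_Suc_mono_le[of "rel_ucs G H"])
  show "rel_ucs G H n \<subseteq> rel_ucs G H (Suc n)" for n
    using normal_com_left[OF rel_ucs_normal[OF H]] subgroup.mem_carrier[OF rel_ucs_subgroup[OF H]]
    by auto
qed fact

lemma rel_ucs_base: "H \<lhd> G \<Longrightarrow> H \<subseteq> rel_ucs G H j"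
  using rel_ucs_antimono[of H 0 j] by simp

lemma rel_ucs_mono: "H \<subseteq> H' \<Longrightarrow> rel_ucs G H j \<subseteq> rel_ucs G H' j"
  by (induction j) auto

lemma conj_nat_pow:
  assumes "g \<in> carrier G" "d \<in> carrier G"
  shows "(g \<otimes> d \<otimes> inv g) [^] (n::nat) = g \<otimes> d [^] n \<otimes> inv g"
  by (induction n) (use assms in \<open>auto simp: m_assoc\<close>)

end

section \<open>Powers of prime exponent modulo a normal subgroup\<close>

context strong_filtration
begin

context
  fixes p :: nat and K :: "'a set"
  assumes p: "prime p" and K: "K \<lhd> G"
    and pow: "\<And>z. z \<in> N 1 \<Longrightarrow> z [^] p \<in> K" and NK: "N (p - 1) \<subseteq> K"
begin

lemma K_sub: "subgroup K G"
  using K by (rule normal_imp_subgroup)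

text \<open>By \<open>mult_pow_prime\<close>, \<open>p\<close>-th powers are multiplicative modulo
  \<open>K\<close>. A bound on them therefore need only be checked on generators.\<close>

lemma subgroup_pow_prime: "subgroup {y \<in> N 0. y [^] p \<in> K} G"
proof (rule subgroupI)
  have "\<one> \<in> {y \<in> N 0. y [^] p \<in> K}"
    using subgroup.one_closed[OF N_subgroup] subgroup.one_closed[OF K_sub] by simp
  then show "{y \<in> N 0. y [^] p \<in> K} \<noteq> {}" by blast
next
  fix y assume "y \<in> {y \<in> N 0. y [^] p \<in> K}"
  then show "inv y \<in> {y \<in> N 0. y [^] p \<in> K}"
    using subgroup.m_inv_closed[OF N_subgroup] subgroup.m_inv_closed[OF K_sub] N_carrier
    by (auto simp: nat_pow_inv)
next
  fix y x assume yx: "y \<in> {y \<in> N 0. y [^] p \<in> K}" "x \<in> {y \<in> N 0. y [^] p \<in> K}"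
  then have c: "y \<in> carrier G" "x \<in> carrier G" using N_carrier by auto
  have "inv (y [^] p) \<otimes> ((y \<otimes> x) [^] p \<otimes> inv (x [^] p)) \<in> K"
    using yx c by (intro mult_pow_prime[OF p K_sub pow NK]) auto
  then have "y [^] p \<otimes> (inv (y [^] p) \<otimes> ((y \<otimes> x) [^] p \<otimes> inv (x [^] p))) \<otimes> x [^] p \<in> K"
    using yx subgroup.m_closed[OF K_sub] by auto
  then show "y \<otimes> x \<in> {y \<in> N 0. y [^] p \<in> K}"
    using c yx subgroup.m_closed[OF N_subgroup] by (simp add: m_assoc)
qed (use N_carrier in auto)

text \<open>\<open>d\<close> is the product of \<open>com G d g\<close> and the conjugate of
  \<open>d\<close> by \<open>g\<close>. Applying \<open>mult_pow_prime\<close> to this product shows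
  that \<open>com G d g [^] p\<close> agrees with \<open>com G (d [^] p) g\<close> modulo
  \<open>K\<close>.\<close>

lemma com_pow_prime:
  assumes d: "d \<in> carrier G" and g: "g \<in> carrier G" and y: "com G d g \<in> N 0"
    and dp: "com G (d [^] p) g \<in> K"
  shows "com G d g [^] p \<in> K"
proof -
  let ?x = "g \<otimes> d \<otimes> inv g" and ?y = "com G d g"
  have yc: "?y \<in> carrier G" using d g by simp
  have "inv (?y [^] p) \<otimes> ((?y \<otimes> ?x) [^] p \<otimes> inv (?x [^] p)) \<in> K"
    using y d g by (intro mult_pow_prime[OF p K_sub pow NK]) auto
  moreover have "?y \<otimes> ?x = d"
    using d g by (simp add: group_word_simps)
  moreover have "d [^] p \<otimes> inv (?x [^] p) = com G (d [^] p) g"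
    using d g by (subst conj_nat_pow) (auto simp: group_word_simps)
  ultimately have "inv (?y [^] p) \<otimes> com G (d [^] p) g \<in> K" by simp
  then have "com G (d [^] p) g \<otimes> inv (inv (?y [^] p) \<otimes> com G (d [^] p) g) \<in> K"
    using dp subgroup.m_closed[OF K_sub] subgroup.m_inv_closed[OF K_sub] by blast
  then show ?thesis using yc d g by (simp add: inv_mult_group)
qed

end

end

section \<open>Lower central series of a conjugation-invariant set\<close>

locale rel_lcs_group = group +
  fixes H X :: "'a set"
  assumes H_normal: "H \<lhd> G" and X_carrier: "X \<subseteq> carrier G"
    and X_conj: "x \<in> X \<Longrightarrow> g \<in> carrier G \<Longrightarrow> g \<otimes> x \<otimes> inv g \<in> X"
begin

abbreviation D :: "nat \<Rightarrow> 'a set" where "D \<equiv> rel_lcs G H X"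

lemma H_sub: "subgroup H G"
  using H_normal by (rule normal_imp_subgroup)

lemma H_carrier: "H \<subseteq> carrier G"
  using subgroup.subset[OF H_sub] .

lemma D_normal: "D m \<lhd> G"
proof (induction m)
  case 0
  have "g \<otimes> h \<otimes> inv g \<in> X \<union> H" if "h \<in> X \<union> H" "g \<in> carrier G" for h g
    using that X_conj normal_conj[OF H_normal] by auto
  then show ?case
    unfolding rel_lcs.simps using X_carrier H_carrier by (intro normal_generateI) auto
next
  case (Suc m)
  let ?S = "{com G d g | d g. d \<in> D m \<and> g \<in> carrier G} \<union> H"
  have D: "D m \<subseteq> carrier G" using Suc normal_imp_subgroup subgroup.subset by blast
  have "generate G ?S \<lhd> G"
  proof (rule normal_generateI)
    show "?S \<subseteq> carrier G" using D H_carrier by auto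
    fix h g assume h: "h \<in> ?S" and g: "g \<in> carrier G"
    show "g \<otimes> h \<otimes> inv g \<in> ?S"
    proof (cases "h \<in> H")
      case True
      then show ?thesis using normal_conj[OF H_normal g] by blast
    next
      case False
      then obtain d k where dk: "h = com G d k" "d \<in> D m" "k \<in> carrier G" using h by blast
      then have "g \<otimes> h \<otimes> inv g = com G (g \<otimes> d \<otimes> inv g) (g \<otimes> k \<otimes> inv g)"
        using D g by (auto simp: group_word_simps)
      then show ?thesis using dk g normal_conj[OF Suc g] by blast
    qed
  qed
  then show ?case by (simp add: rel_lcs.simps)
qed

lemma D_sub: "subgroup (D m) G"
  using D_normal normal_imp_subgroup by blast

lemma D_carrier: "d \<in> D m \<Longrightarrow> d \<in> carrier G"
  using subgroup.mem_carrier[OF D_sub] .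

lemma H_D: "H \<subseteq> D m"
  by (cases m) (auto simp: rel_lcs.simps intro: generate.incl)

lemma com_D: "d \<in> D m \<Longrightarrow> g \<in> carrier G \<Longrightarrow> com G d g \<in> D (Suc m)"
  by (auto simp: rel_lcs.simps intro!: generate.incl)

lemma D_Suc_minimal:
  assumes "subgroup K G" "H \<subseteq> K"
    "\<And>d g. d \<in> D m \<Longrightarrow> g \<in> carrier G \<Longrightarrow> com G d g \<in> K"
  shows "D (Suc m) \<subseteq> K"
  unfolding rel_lcs.simps using assms by (intro generate_subgroup_incl) auto

lemma D_Suc: "D (Suc m) \<subseteq> D m"
  using D_sub H_D normal_com_left[OF D_normal] by (intro D_Suc_minimal)

lemma D_antimono: "i \<le> j \<Longrightarrow> D j \<subseteq> D i"
  by (rule lift_Suc_antimono_le[of D]) (use D_Suc in auto)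

text \<open>The set ranges over all \<open>i\<close> at once because the induction in
  \<open>D_com\<close> uses the claim at both \<open>i\<close> and \<open>Suc i\<close>.\<close>

lemma D_com_subgroup: "subgroup {g \<in> carrier G. \<forall>i. \<forall>a\<in>D i. com G a g \<in> D (i + j)} G"
  (is "subgroup ?S G")
proof (rule subgroupI)
  have "\<one> \<in> ?S"
    using D_carrier subgroup.one_closed[OF D_sub] by (auto simp: com_def)
  then show "?S \<noteq> {}" by blast
next
  fix g assume g: "g \<in> ?S"
  have "com G a (inv g) \<in> D (i + j)" if a: "a \<in> D i" for a i
  proof -
    have "inv g \<otimes> inv (com G a g) \<otimes> inv (inv g) \<in> D (i + j)"
      using a g by (intro normal_conj[OF D_normal] subgroup.m_inv_closed[OF D_sub]) auto
    then show ?thesis using g D_carrier[OF a] by (simp add: group_word_simps)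
  qed
  then show "inv g \<in> ?S" using g by auto
next
  fix g h assume g: "g \<in> ?S" and h: "h \<in> ?S"
  have "com G a (g \<otimes> h) \<in> D (i + j)" if a: "a \<in> D i" for a i
  proof -
    have "com G a g \<otimes> (g \<otimes> com G a h \<otimes> inv g) \<in> D (i + j)"
      using a g h by (intro subgroup.m_closed[OF D_sub] normal_conj[OF D_normal]) auto
    then show ?thesis using g h D_carrier[OF a] by (simp add: group_word_simps)
  qed
  then show "g \<otimes> h \<in> ?S" using g h by auto
qed auto

text \<open>The three subgroups argument, by induction on \<open>j\<close>. The extra one in the
  index appears because already \<open>D 0\<close>, being a subset of \<open>G\<close>, raises the
  index by one.\<close>

lemma D_com:
  assumes "x \<in> D i" "y \<in> D j"
  shows "com G x y \<in> D (Suc (i + j))"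
proof -
  define S where "S j = {g \<in> carrier G. \<forall>i. \<forall>a\<in>D i. com G a g \<in> D (i + j)}" for j
  have S_sub: "subgroup (S j) G" for j
    unfolding S_def by (rule D_com_subgroup)
  have SI: "g \<in> S j" if "g \<in> carrier G" "\<And>i a. a \<in> D i \<Longrightarrow> com G a g \<in> D (i + j)" for g j
    using that by (simp add: S_def)
  have "D j \<subseteq> S (Suc j)" for j
  proof (induction j)
    case 0
    show ?case using D_carrier com_D by (auto intro!: SI)
  next
    case (Suc j)
    show ?case
    proof (rule D_Suc_minimal)
      show "subgroup (S (Suc (Suc j))) G" by (rule S_sub)
      show "H \<subseteq> S (Suc (Suc j))"
        using H_D normal_com_right[OF H_normal] H_carrier D_carrier by (blast intro: SI)
    next
      fix d g assume d: "d \<in> D j" and g: "g \<in> carrier G"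
      have dc: "d \<in> carrier G" and dS: "d \<in> S (Suc j)"
        using d Suc D_carrier by auto
      show "com G d g \<in> S (Suc (Suc j))"
      proof (rule SI)
        show "com G d g \<in> carrier G" using dc g by simp
        fix i a' assume a': "a' \<in> D i"
        let ?K = "D (i + Suc (Suc j))"
        \<comment> \<open>Passing from \<open>a'\<close> to its conjugate \<open>a\<close> absorbs
          the conjugations in the Hall-Witt identity: the commutator of \<open>com G d g\<close>
          with \<open>a'\<close> becomes a product of three commutators or inverses of such, all in
          \<open>?K\<close>.\<close>
        define a where "a = inv (g \<otimes> d) \<otimes> a' \<otimes> inv (inv (g \<otimes> d))"
        have a: "a \<in> D i" unfolding a_def by (intro normal_conj[OF D_normal] a') (use dc g in auto)
        note ac = D_carrier[OF a] D_carrier[OF a']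
        have a'_eq: "a' = g \<otimes> (d \<otimes> (a \<otimes> (inv d \<otimes> inv g)))"
          using ac dc g by (simp add: a_def m_assoc inv_mult_group)
        have "com G d a \<in> D (i + Suc j)"
          using dS a ac dc subgroup.m_inv_closed[OF D_sub, of "com G a d"]
          unfolding S_def by (auto simp: inv_com)
        then have e: "com G d a \<in> D (i + Suc j)" "com G g (com G d a) \<in> ?K"
            "com G (com G g a) (com G d a) \<in> ?K"
          using com_D[of "com G d a" "i + Suc j"] ac dc g
            subgroup.m_inv_closed[OF D_sub, of "com G (com G d a) _"]
          by (metis add_Suc_right com_closed inv_com)+
        have "com G g a \<in> D (Suc i)"
          using com_D[OF a g] ac g subgroup.m_inv_closed[OF D_sub] inv_com by metis
        then have "com G (com G g a) d \<in> D (Suc i + Suc j)"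
          using dS unfolding S_def by blast
        then have f: "com G d (com G g a) \<in> ?K"
          using ac dc g subgroup.m_inv_closed[OF D_sub, of "com G (com G g a) d"]
          by (simp add: inv_com)
        have "com G a' (com G d g) = inv (com G (com G d g) a')"
          using ac dc g by (simp add: inv_com)
        also have "com G (com G d g) a' =
            com G d (com G g a) \<otimes> com G (com G g a) (com G d a) \<otimes> inv (com G g (com G d a))"
          unfolding a'_eq using ac(1) dc g by (simp add: group_word_simps)
        also have "inv \<dots> \<in> ?K"
          using e f by (intro subgroup.m_inv_closed[OF D_sub] subgroup.m_closed[OF D_sub])
        finally show "com G a' (com G d g) \<in> ?K" .
      qed
    qed
  qed
  then show ?thesis using assms by (auto simp: S_def)
qed

text \<open>Commutators of \<open>D (m + i)\<close> with \<open>D (m + j)\<close> have index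
  \<open>Suc (m + i + m + j)\<close>, at least as deep as required. So \<open>mult_pow_prime\<close>
  is available from any level \<open>m\<close>.\<close>

lemma strong_filtration_D: "strong_filtration G (\<lambda>j. D (m + j))"
proof (intro strong_filtration.intro strong_filtration_axioms.intro group_axioms)
  show "com G x y \<in> D (m + Suc (i + j))" if "x \<in> D (m + i)" "y \<in> D (m + j)" for x y i j
  proof -
    have "Suc ((m + i) + (m + j)) \<ge> m + Suc (i + j)" by simp
    then show ?thesis using D_com[OF that] D_antimono by blast
  qed
  show "com G x g \<in> D (m + Suc j)" if "x \<in> D (m + j)" "g \<in> carrier G" for x g j
    using com_D[OF that] by simp
  show "D (m + Suc j) \<subseteq> D (m + j)" for j
    using D_Suc by simp
qed (rule D_normal)

text \<open>With \<open>rel_ucs_D\<close> this exchanges the two series: falling into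
  \<open>K\<close> after \<open>b\<close> more commutators means lying in the \<open>b\<close>-th
  upper term over \<open>K\<close>.\<close>

lemma D_rel_ucs: "D (a + b) \<subseteq> K \<Longrightarrow> D a \<subseteq> rel_ucs G K b"
proof (induction b arbitrary: a)
  case (Suc b)
  then have "D (Suc a) \<subseteq> rel_ucs G K b" by simp
  then show ?case using com_D D_carrier by (auto)
qed simp

lemma rel_ucs_D: "D a \<subseteq> rel_ucs G H b \<Longrightarrow> D (a + b) \<subseteq> H"
proof (induction b arbitrary: a)
  case (Suc b)
  have "H \<subseteq> rel_ucs G H b" using rel_ucs_base[OF H_normal] .
  then have "D (Suc a) \<subseteq> rel_ucs G H b"
    using Suc.prems by (intro D_Suc_minimal rel_ucs_subgroup[OF H_normal]) auto
  then show ?case using Suc.IH[of "Suc a"] by simp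
qed simp

text \<open>With \<open>Z\<close> the upper central series modulo \<open>D (n + p - 1)\<close>, one shows \<open>(D m)\<^sup>p \<subseteq> Z\<^sub>n\<^sub>-\<^sub>m\<close> for all \<open>m \<le> n\<close>. The outer induction descends
  in \<open>n\<close> and makes \<open>(D (m + 1))\<^sup>p\<close> vanish modulo \<open>Z\<^sub>n\<^sub>-\<^sub>m\<close>, as \<open>mult_pow_prime\<close> requires;
  the inner one ascends in \<open>m\<close>, since then \<open>[d, g]\<^sup>p \<equiv> [d\<^sup>p, g]\<close>.\<close>

lemma pow_D:
  assumes p: "prime p" and Xk: "\<And>x. x \<in> X \<Longrightarrow> x [^] p \<in> rel_ucs G H k"
    and N: "D N \<subseteq> H" and n: "k \<le> n" and d: "d \<in> D n"
  shows "d [^] p \<in> D (n + p - 1)"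
proof -
  have p1: "p \<ge> 1" using prime_ge_1_nat[OF p] .
  have "\<forall>m\<le>n. \<forall>d\<in>D m. d [^] p \<in> rel_ucs G (D (n + p - 1)) (n - m)"
    if "k \<le> n" "n \<le> max k N" for n
    using that(2,1)
  proof (induction n rule: inc_induct)
    case base
    show ?case
    proof (intro allI impI ballI)
      fix m d assume m: "m \<le> max k N" and d: "d \<in> D m"
      have "D (m + (max k N - m)) \<subseteq> H" using m N D_antimono[of N "max k N"] by auto
      then have "D m \<subseteq> rel_ucs G (D (max k N + p - 1)) (max k N - m)"
        using D_rel_ucs[of m "max k N - m"] H_D by blast
      then show "d [^] p \<in> rel_ucs G (D (max k N + p - 1)) (max k N - m)"
        using d subgroup_nat_pow_closed[OF rel_ucs_subgroup[OF D_normal]] by blast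
    qed
  next
    case (step n)
    let ?K = "D (n + p - 1)"
    have IH: "d [^] p \<in> rel_ucs G ?K (Suc n - m)" if "m \<le> Suc n" "d \<in> D m" for m d
    proof -
      have "d [^] p \<in> rel_ucs G (D (Suc n + p - 1)) (Suc n - m)"
        using step that by simp
      moreover have "D (Suc n + p - 1) \<subseteq> ?K" using D_antimono by simp
      ultimately show ?thesis using rel_ucs_mono by blast
    qed
    have "\<forall>d\<in>D m. d [^] p \<in> rel_ucs G ?K (n - m)" if "m \<le> n" for m
      using that
    proof (induction m)
      case 0
      let ?B = "rel_ucs G ?K (n - 0)"
      interpret F: strong_filtration G "\<lambda>j. D (0 + j)" by (rule strong_filtration_D)
      have "subgroup {y \<in> D (0 + 0). y [^] p \<in> ?B} G"
      proof (rule F.subgroup_pow_prime[OF p])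
        show "?B \<lhd> G" by (rule rel_ucs_normal[OF D_normal])
        show "z [^] p \<in> ?B" if "z \<in> D (0 + 1)" for z
          using IH[of 1 z] that by simp
        show "D (0 + (p - 1)) \<subseteq> ?B"
          using D_rel_ucs[of "p - 1" n ?K] p1 by (simp add: add.commute)
      qed
      \<comment> \<open>The generators start the inner induction: their \<open>p\<close>-th powers
        lie in the upper term \<open>k\<close>, hence in term \<open>n\<close> since
        \<open>k \<le> n\<close>.\<close>
      moreover have "X \<union> H \<subseteq> {y \<in> D (0 + 0). y [^] p \<in> ?B}"
      proof -
        have "rel_ucs G H k \<subseteq> ?B"
          using rel_ucs_antimono[OF H_normal step.prems] rel_ucs_mono[OF H_D] by auto
        moreover have "h [^] p \<in> ?B" if "h \<in> H" for h
          using subgroup_nat_pow_closed[OF H_sub that] rel_ucs_base[OF D_normal] H_D by blast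
        ultimately show ?thesis using Xk by (auto simp: rel_lcs.simps intro: generate.incl)
      qed
      ultimately have "D 0 \<subseteq> {y \<in> D (0 + 0). y [^] p \<in> ?B}"
        unfolding rel_lcs.simps(1) by (rule generate_subgroup_incl[rotated])
      then show ?case by auto
    next
      case (Suc m)
      let ?B = "rel_ucs G ?K (n - Suc m)"
      interpret F: strong_filtration G "\<lambda>j. D (Suc m + j)" by (rule strong_filtration_D)
      have B: "?B \<lhd> G" by (rule rel_ucs_normal[OF D_normal])
      have B1: "z [^] p \<in> ?B" if "z \<in> D (Suc m + 1)" for z
        using IH[of "Suc (Suc m)" z] that Suc.prems by simp
      have B2: "D (Suc m + (p - 1)) \<subseteq> ?B"
      proof (rule D_rel_ucs)
        have eq: "Suc m + (p - 1) + (n - Suc m) = n + p - 1" using Suc.prems p1 by simp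
        show "D (Suc m + (p - 1) + (n - Suc m)) \<subseteq> ?K" unfolding eq by simp
      qed
      have "subgroup {y \<in> D (Suc m + 0). y [^] p \<in> ?B} G"
        by (rule F.subgroup_pow_prime[OF p B B1 B2])
      then have "D (Suc m) \<subseteq> {y \<in> D (Suc m + 0). y [^] p \<in> ?B}"
      proof (rule D_Suc_minimal)
        have "h [^] p \<in> ?B" if "h \<in> H" for h
          using subgroup_nat_pow_closed[OF H_sub that] rel_ucs_base[OF D_normal] H_D by blast
        then show "H \<subseteq> {y \<in> D (Suc m + 0). y [^] p \<in> ?B}" using H_D by auto
      next
        fix d g assume d: "d \<in> D m" and g: "g \<in> carrier G"
        have "d [^] p \<in> rel_ucs G ?K (Suc (n - Suc m))"
          using Suc d by (simp add: Suc_diff_Suc del: rel_ucs.simps)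
        then have "com G (d [^] p) g \<in> ?B" using g by simp
        moreover have "com G d g \<in> D (Suc m + 0)" using com_D[OF d g] by simp
        ultimately have "com G d g [^] p \<in> ?B"
          using F.com_pow_prime[OF p B B1 B2 D_carrier[OF d] g] by simp
        then show "com G d g \<in> {y \<in> D (Suc m + 0). y [^] p \<in> ?B}" using com_D[OF d g] by simp
      qed
      then show ?case by auto
    qed
    then show ?case by blast
  qed
  note main = this
  \<comment> \<open>The case \<open>m = n\<close> is the claim, since the upper term of index 0 is
    the modulus itself.\<close>
  show ?thesis
  proof (cases "n \<le> max k N")
    case True
    then show ?thesis using main[OF n True] d by fastforce
  next
    case False
    then have "N \<le> n" by simp
    then have "D n \<subseteq> H" using N D_antimono by blast
    then show ?thesis using d subgroup_nat_pow_closed[OF H_sub] H_D by blast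
  qed
qed

end

section \<open>Elements of order a power of p\<close>

context group
begin

lemma rel_lcs_group_roots:
  assumes "H \<lhd> G"
  shows "rel_lcs_group G H {x \<in> carrier G. x [^] (m::nat) \<in> H}"
proof (intro rel_lcs_group.intro rel_lcs_group_axioms.intro group_axioms assms)
  fix x g assume "x \<in> {x \<in> carrier G. x [^] m \<in> H}" "g \<in> carrier G"
  then show "g \<otimes> x \<otimes> inv g \<in> {x \<in> carrier G. x [^] m \<in> H}"
    using normal_conj[OF assms] by (auto simp: conj_nat_pow)
qed auto

text \<open>The bound on \<open>k\<close> is used in the descending induction showing that \<open>p\<close>-th powers of \<open>D n\<close> vanish for \<open>n \<ge> k\<close>:
  once they do for \<open>n + 1\<close>, \<open>D (n + 1 + k)\<close> is trivial, which contains \<open>(D n)\<^sup>p\<close> if \<open>k \<le> p - 2\<close>. If \<open>k = p - 1\<close>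
  one only gets exponent \<open>p\<^sup>2\<close> for \<open>D n\<close>, and \<open>i \<ge> 2\<close> then improves the triviality to \<open>D (n + k)\<close>.\<close>

lemma prime_roots_step:
  assumes p: "prime p" and k: "k \<ge> 1" and i: "i \<ge> 1"
    and ki: "k \<le> p - 2 \<or> (k = p - 1 \<and> i \<ge> 2)"
    and H: "H \<lhd> G"
    and hk: "\<And>x. x \<in> carrier G \<Longrightarrow> x [^] (p ^ i) \<in> H \<Longrightarrow> x \<in> rel_ucs G H k"
    and hN: "\<And>x. x \<in> carrier G \<Longrightarrow> x [^] (p ^ Suc i) \<in> H \<Longrightarrow> x \<in> rel_ucs G H N"
  defines "W \<equiv> {x \<in> carrier G. x [^] p \<in> H}"
  shows "W \<lhd> G" and "\<And>x. x \<in> carrier G \<Longrightarrow> x [^] (p ^ Suc i) \<in> H \<Longrightarrow> x \<in> rel_ucs G W k"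
proof -
  have H_sub: "subgroup H G" using H by (rule normal_imp_subgroup)
  have root_le: "x [^] (p ^ b) \<in> H" if "x \<in> carrier G" "x [^] (p ^ a) \<in> H" "a \<le> b" for x a b
  proof -
    have "(x [^] (p ^ a)) [^] (p ^ (b - a)) \<in> H"
      by (rule subgroup_nat_pow_closed[OF H_sub that(2)])
    then show ?thesis using that by (simp add: nat_pow_pow flip: power_add)
  qed
  have Hc: "H \<subseteq> carrier G" using subgroup.subset[OF H_sub] .
  have WI: "x \<in> W" if "x \<in> carrier G" "x [^] p \<in> H" for x
    using that by (simp add: W_def)
  have HW: "H \<subseteq> W"
    using subgroup_nat_pow_closed[OF H_sub] Hc by (auto simp: W_def)
  have W_k: "W \<subseteq> rel_ucs G H k"
    using hk root_le[of _ 1 i] i by (auto simp: W_def)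
  have W_normal: "W \<lhd> G"
  proof -
    interpret W: rel_lcs_group G H W
      unfolding W_def by (rule rel_lcs_group_roots[OF H])
    have "W.D 0 \<subseteq> rel_ucs G H k"
      unfolding rel_lcs.simps
      using W_k rel_ucs_base[OF H] by (intro generate_subgroup_incl rel_ucs_subgroup[OF H]) auto
    then have Dk: "W.D k \<subseteq> H" using W.rel_ucs_D[of 0 k] by simp
    \<comment> \<open>\<open>pow_D\<close> applies with 0 in place of \<open>k\<close>, as
      \<open>p\<close>-th powers of \<open>W\<close> lie in \<open>H\<close>. It sends
      \<open>W.D 0\<close> into \<open>W.D (p - 1)\<close>, which is inside \<open>W.D k\<close>
      because \<open>k \<le> p - 1\<close>.\<close>
    have "d [^] p \<in> H" if "d \<in> W.D 0" for d
    proof -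
      have "d [^] p \<in> W.D (0 + p - 1)"
        by (rule W.pow_D[OF p _ Dk _ that, of 0]) (auto simp: W_def)
      moreover have "W.D (0 + p - 1) \<subseteq> W.D k" using ki by (intro W.D_antimono) auto
      ultimately show ?thesis using Dk by blast
    qed
    then have "W.D 0 \<subseteq> W" using W.D_carrier WI by blast
    moreover have "W \<subseteq> W.D 0" by (auto simp: rel_lcs.simps intro: generate.incl)
    ultimately show ?thesis using W.D_normal[of 0] by simp
  qed
  then show "W \<lhd> G" .
  define X where "X = {x \<in> carrier G. x [^] (p ^ Suc i) \<in> H}"
  interpret X: rel_lcs_group G H X
    unfolding X_def by (rule rel_lcs_group_roots[OF H])
  have "X.D 0 \<subseteq> rel_ucs G H N"
    unfolding rel_lcs.simps
    using hN rel_ucs_base[OF H] by (intro generate_subgroup_incl rel_ucs_subgroup[OF H]) (auto simp: X_def)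
  then have DN: "X.D N \<subseteq> H" using X.rel_ucs_D[of 0 N] by simp
  have Xp: "x [^] p \<in> rel_ucs G H k" if "x \<in> X" for x
    using that by (intro hk) (auto simp: X_def nat_pow_pow)
  have pow: "d [^] p \<in> X.D (n + p - 1)" if "k \<le> n" "d \<in> X.D n" for n d
    using X.pow_D[OF p Xp DN that] .
  have "X.D n \<subseteq> W" if "n \<le> max k N" "k \<le> n" for n
    using that
  proof (induction n rule: inc_induct)
    case base
    then show ?case using X.D_antimono[of N "max k N"] DN HW by auto
  next
    case (step n)
    then have sub: "X.D (Suc n) \<subseteq> W" by simp
    then have Dk: "X.D (Suc n + k) \<subseteq> H"
      using W_k X.rel_ucs_D[of "Suc n" k] by blast
    have "d [^] p \<in> H" if d: "d \<in> X.D n" for d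
      using ki
    proof
      assume "k \<le> p - 2"
      then have "X.D (n + p - 1) \<subseteq> X.D (Suc n + k)" using k by (intro X.D_antimono) auto
      then show ?thesis using Dk pow[OF step.prems d] by blast
    next
      assume *: "k = p - 1 \<and> i \<ge> 2"
      have "X.D n \<subseteq> rel_ucs G H k"
      proof
        fix d assume d: "d \<in> X.D n"
        have "d [^] p \<in> X.D (n + p - 1)" using pow[OF step.prems d] .
        moreover have "X.D (n + p - 1) \<subseteq> X.D (Suc n)"
          using k * by (intro X.D_antimono) auto
        ultimately have "d [^] p \<in> W" using sub by blast
        then have "d [^] (p ^ 2) \<in> H"
          using X.D_carrier[OF d] by (simp add: W_def nat_pow_pow power2_eq_square)
        then show "d \<in> rel_ucs G H k"
          using hk root_le[of d 2 i] * X.D_carrier[OF d] by blast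
      qed
      then have "X.D (n + k) \<subseteq> H" by (rule X.rel_ucs_D)
      moreover have "n + p - 1 = n + k" using * k by simp
      ultimately show ?thesis using pow[OF step.prems d] by auto
    qed
    then show ?case using X.D_carrier WI by blast
  qed
  from this[of k] have "X.D k \<subseteq> W" by simp
  then have "X.D 0 \<subseteq> rel_ucs G W k" using X.D_rel_ucs[of 0 k W] by simp
  then show "x \<in> rel_ucs G W k" if "x \<in> carrier G" "x [^] (p ^ Suc i) \<in> H" for x
    using that by (auto simp: X_def rel_lcs.simps intro: generate.incl)
qed

text \<open>Induction on \<open>j\<close>: \<open>prime_roots_step\<close> is applied modulo the set
  for \<open>j\<close>, whose \<open>p\<close>-th roots form the set for \<open>Suc j\<close>. One
  \<open>N\<close> serves all exponents, so the nilpotency bound survives each passage to a larger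
  modulus.\<close>

theorem p_power_roots_normal:
  assumes p: "prime p" and k: "k \<ge> 1" and i: "i \<ge> 1"
    and ki: "k \<le> p - 2 \<or> (k = p - 1 \<and> i \<ge> 2)"
    and hk: "\<And>x. x \<in> carrier G \<Longrightarrow> x [^] (p ^ i) = \<one> \<Longrightarrow> x \<in> rel_ucs G {\<one>} k"
    and hN: "\<And>x j. x \<in> carrier G \<Longrightarrow> x [^] (p ^ j) = \<one> \<Longrightarrow> x \<in> rel_ucs G {\<one>} N"
  shows "{x \<in> carrier G. x [^] (p ^ j) = \<one>} \<lhd> G"
    and "\<And>x. x \<in> carrier G \<Longrightarrow> x [^] (p ^ (i + j)) = \<one> \<Longrightarrow>
      x \<in> rel_ucs G {x \<in> carrier G. x [^] (p ^ j) = \<one>} k"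
proof -
  define F where "F j = {x \<in> carrier G. x [^] (p ^ j) = \<one>}" for j
  have F_pow: "x [^] (p ^ a) \<in> F j \<longleftrightarrow> x [^] (p ^ (a + j)) = \<one>" if "x \<in> carrier G" for x a j
    using that by (simp add: F_def nat_pow_pow power_add)
  have "F j \<lhd> G \<and> (\<forall>x\<in>carrier G. x [^] (p ^ (i + j)) = \<one> \<longrightarrow> x \<in> rel_ucs G (F j) k)"
  proof (induction j)
    case 0
    have "F 0 = {\<one>}" by (auto simp: F_def)
    then show ?case using one_is_normal hk by simp
  next
    case (Suc j)
    have FSuc: "{x \<in> carrier G. x [^] p \<in> F j} = F (Suc j)"
      using F_pow[of _ 1 j] by (auto simp: F_def)
    have F: "F j \<lhd> G" using Suc by simp
    have "{\<one>} \<subseteq> F j" by (auto simp: F_def)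
    then have hN': "x \<in> rel_ucs G (F j) N" if "x \<in> carrier G" "x [^] (p ^ Suc i) \<in> F j" for x
      using hN[of x "Suc i + j"] that F_pow[of x "Suc i" j] rel_ucs_mono by blast
    have hk': "x \<in> rel_ucs G (F j) k" if "x \<in> carrier G" "x [^] (p ^ i) \<in> F j" for x
      using Suc that F_pow by blast
    note step = prime_roots_step[OF p k i ki F hk' hN', unfolded FSuc]
    have "x \<in> rel_ucs G (F (Suc j)) k"
      if "x \<in> carrier G" "x [^] (p ^ (i + Suc j)) = \<one>" for x
      using step(2)[of x] that F_pow[of x "Suc i" j] by simp
    then show ?case using step(1) by simp
  qed
  then show "{x \<in> carrier G. x [^] (p ^ j) = \<one>} \<lhd> G"
    "\<And>x. x \<in> carrier G \<Longrightarrow> x [^] (p ^ (i + j)) = \<one> \<Longrightarrow>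
      x \<in> rel_ucs G {x \<in> carrier G. x [^] (p ^ j) = \<one>} k"
    by (auto simp: F_def)
qed

section \<open>Passage between relative series and quotient groups\<close>

lemma rcos_eq_iff:
  assumes "subgroup H G" "x \<in> carrier G" "y \<in> carrier G"
  shows "H #> x = H #> y \<longleftrightarrow> x \<otimes> inv y \<in> H"
  using assms by (metis repr_independence repr_independenceD rcos_self subgroup.rcos_module group_axioms)

text \<open>Two cosets commute exactly when the commutator of their representatives lies in the
  subgroup; this turns centres of quotients into commutator conditions inside
  \<open>G\<close>.\<close>

lemma upper_central_series_eq_rel_ucs: "upper_central_series G k = rel_ucs G {\<one>} k"
proof (induction k)
  case (Suc k)
  let ?U = "rel_ucs G {\<one>} k"
  have U: "?U \<lhd> G" by (rule rel_ucs_normal[OF one_is_normal])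
  have U_sub: "subgroup ?U G" using U by (rule normal_imp_subgroup)
  have "?U #> x \<in> center (G Mod ?U) \<longleftrightarrow> (\<forall>g\<in>carrier G. com G x g \<in> ?U)" if x: "x \<in> carrier G" for x
  proof -
    have "(?U #> x) <#> (?U #> g) = (?U #> g) <#> (?U #> x) \<longleftrightarrow> com G x g \<in> ?U"
      if g: "g \<in> carrier G" for g
      using x g by (simp add: normal.rcos_sum[OF U] rcos_eq_iff[OF U_sub] group_word_simps)
    then show ?thesis
      using x by (auto simp: center_def carrier_FactGroup)
  qed
  then show ?case using Suc by auto
qed simp

lemma group_hom_Mod: "H \<lhd> G \<Longrightarrow> group_hom G (G Mod H) (\<lambda>x. H #> x)"
  using normal.factorgroup_is_group normal.r_coset_hom_Mod
  by (intro group_hom.intro group_hom_axioms.intro group_axioms)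

lemma rel_ucs_Mod:
  assumes "H \<lhd> G" "x \<in> carrier G"
  shows "H #> x \<in> rel_ucs (G Mod H) {\<one>\<^bsub>G Mod H\<^esub>} k \<longleftrightarrow> x \<in> rel_ucs G H k"
  using assms(2)
proof (induction k arbitrary: x)
  case 0
  have "subgroup H G" using assms(1) by (rule normal_imp_subgroup)
  then show ?case using 0 coset_join1 coset_join2 subgroup.subset by auto
next
  case (Suc k)
  note hom = group_hom_Mod[OF assms(1)]
  have com: "com (G Mod H) (H #> x) (H #> g) = H #> com G x g" if "g \<in> carrier G" for g
    using Suc.prems that group_hom.hom_mult[OF hom] group_hom.hom_inv[OF hom]
    by (simp add: com_def del: mult_FactGroup)
  show ?case
    using Suc by (simp add: carrier_FactGroup com)
qed

end

section \<open>Finite normal subgroups of pro-p groups\<close>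

lemma card_image_eq_if_same_kernel:
  assumes "\<And>x y. x \<in> A \<Longrightarrow> y \<in> A \<Longrightarrow> f x = f y \<longleftrightarrow> g x = g y"
  shows "card (f ` A) = card (g ` A)"
proof -
  have "bij_betw (\<lambda>z. g (inv_into A f z)) (f ` A) (g ` A)"
  proof (rule bij_betw_imageI)
    show "inj_on (\<lambda>z. g (inv_into A f z)) (f ` A)"
      by (rule inj_onI) (metis assms f_inv_into_f inv_into_into)
    show "(\<lambda>z. g (inv_into A f z)) ` (f ` A) = g ` A"
      unfolding image_image
      by (intro image_cong refl) (metis assms f_inv_into_f imageI inv_into_into)
  qed
  then show ?thesis by (rule bij_betw_same_card)
qed

context group
begin

lemma rcosets_eq_image: "rcosets H = (\<lambda>x. H #> x) ` carrier G"
  by (auto simp: RCOSETS_def)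

lemma rcos_eq_self_iff: "subgroup H G \<Longrightarrow> x \<in> carrier G \<Longrightarrow> H #> x = H \<longleftrightarrow> x \<in> H"
  using coset_join1 coset_join2 subgroup.subset by metis

text \<open>The correspondence theorem for indices. The cosets are matched by an explicit bijection,
  so the equality of \<open>card\<close> also covers infinite index.\<close>

lemma card_rcosets_Mod:
  assumes H: "H \<lhd> G" and N: "subgroup N (G Mod H)"
  shows "subgroup {x \<in> carrier G. H #> x \<in> N} G"
    and "card (rcosets\<^bsub>G Mod H\<^esub> N) = card (rcosets {x \<in> carrier G. H #> x \<in> N})"
proof -
  let ?S = "{x \<in> carrier G. H #> x \<in> N}"
  interpret q: group_hom G "G Mod H" "\<lambda>x. H #> x" by (rule group_hom_Mod[OF H])
  show S: "subgroup ?S G"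
  proof (rule subgroupI)
    have "\<one> \<in> ?S" using subgroup.one_closed[OF N] q.hom_one by simp
    then show "?S \<noteq> {}" by blast
  next
    fix x assume "x \<in> ?S"
    then show "inv x \<in> ?S" using q.hom_inv subgroup.m_inv_closed[OF N] by auto
  next
    fix x y assume "x \<in> ?S" "y \<in> ?S"
    then show "x \<otimes> y \<in> ?S" using q.hom_mult subgroup.m_closed[OF N] by (auto simp del: mult_FactGroup)
  qed auto
  have eq: "rcosets\<^bsub>G Mod H\<^esub> N = (\<lambda>x. N #>\<^bsub>G Mod H\<^esub> (H #> x)) ` carrier G"
    unfolding q.H.rcosets_eq_image by (simp add: carrier_FactGroup image_image)
  have ker: "N #>\<^bsub>G Mod H\<^esub> (H #> x) = N #>\<^bsub>G Mod H\<^esub> (H #> y) \<longleftrightarrow> ?S #> x = ?S #> y"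
    if "x \<in> carrier G" "y \<in> carrier G" for x y
    using that q.H.rcos_eq_iff[OF N, of "H #> x" "H #> y"] rcos_eq_iff[OF S, of x y]
      q.hom_mult[of x "inv y"] q.hom_inv[of y] q.hom_closed by (simp del: mult_FactGroup)
  show "card (rcosets\<^bsub>G Mod H\<^esub> N) = card (rcosets ?S)"
    unfolding eq rcosets_eq_image by (rule card_image_eq_if_same_kernel[OF ker])
qed

text \<open>Lagrange is applied in \<open>G Mod C\<close>, since \<open>G\<close> itself may be
  infinite.\<close>

lemma card_rcosets_dvd:
  assumes C: "C \<lhd> G" and S: "subgroup S G" and CS: "C \<subseteq> S"
  shows "card (rcosets S) dvd card (rcosets C)"
proof -
  interpret q: group_hom G "G Mod C" "\<lambda>x. C #> x" by (rule group_hom_Mod[OF C])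
  have sub: "subgroup ((\<lambda>x. C #> x) ` S) (G Mod C)"
    using S by (rule q.subgroup_img_is_subgroup)
  have "{x \<in> carrier G. C #> x \<in> (\<lambda>x. C #> x) ` S} = S"
  proof -
    have "x \<in> S" if "x \<in> carrier G" "y \<in> S" "C #> x = C #> y" for x y
    proof -
      have "x \<otimes> inv y \<in> S"
        using that rcos_eq_iff[OF normal_imp_subgroup[OF C], of x y] subgroup.mem_carrier[OF S] CS by auto
      then have "x \<otimes> inv y \<otimes> y \<in> S" using that subgroup.m_closed[OF S] by blast
      then show ?thesis using that subgroup.mem_carrier[OF S] by (simp add: m_assoc)
    qed
    then show ?thesis using subgroup.mem_carrier[OF S] by auto
  qed
  then have "card (rcosets\<^bsub>G Mod C\<^esub> ((\<lambda>x. C #> x) ` S)) = card (rcosets S)"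
    using card_rcosets_Mod(2)[OF C sub] by simp
  moreover have "card (rcosets C) = order (G Mod C)"
    by (simp add: order_def carrier_FactGroup rcosets_eq_image)
  ultimately show ?thesis
    using q.H.lagrange[OF sub] by (metis dvd_triv_left)
qed

end

section \<open>Quotients of topological and pro-p groups\<close>

context topological_group
begin

lemma continuous_left_mult: "g \<in> carrier G \<Longrightarrow> continuous_map T T (\<lambda>x. g \<otimes> x)"
proof -
  assume g: "g \<in> carrier G"
  have "continuous_map T (prod_topology T T) (\<lambda>x. (g, x))"
    using g by (intro continuous_map_pairedI) (auto simp: topspace_eq)
  from continuous_map_compose[OF this continuous_mult] show ?thesis by (simp add: o_def)
qed

lemma continuous_conj: "f \<in> carrier G \<Longrightarrow> continuous_map T T (\<lambda>g. g \<otimes> f \<otimes> inv g)"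
proof -
  assume f: "f \<in> carrier G"
  have "continuous_map T (prod_topology T T) (\<lambda>g. (g, f))"
    using f by (intro continuous_map_pairedI) (auto simp: topspace_eq)
  from continuous_map_compose[OF this continuous_mult]
  have "continuous_map T (prod_topology T T) (\<lambda>g. (g \<otimes> f, inv g))"
    by (intro continuous_map_pairedI continuous_inv) (simp add: o_def)
  from continuous_map_compose[OF this continuous_mult] show ?thesis by (simp add: o_def)
qed

lemma left_translate_eq_preimage:
  "h \<in> carrier G \<Longrightarrow> U \<subseteq> carrier G \<Longrightarrow> (\<lambda>u. h \<otimes> u) ` U = {x \<in> topspace T. inv h \<otimes> x \<in> U}"
  unfolding topspace_eq by (auto simp: image_iff) (metis inv_closed mult_inv_cancel)

lemma openin_left_translate: "h \<in> carrier G \<Longrightarrow> openin T U \<Longrightarrow> openin T ((\<lambda>u. h \<otimes> u) ` U)"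
  using openin_continuous_map_preimage[OF continuous_left_mult[of "inv h"]]
    left_translate_eq_preimage openin_subset topspace_eq by (metis inv_closed)

lemma closedin_left_translate: "h \<in> carrier G \<Longrightarrow> closedin T U \<Longrightarrow> closedin T ((\<lambda>u. h \<otimes> u) ` U)"
  using closedin_continuous_map_preimage[OF continuous_left_mult[of "inv h"]]
    left_translate_eq_preimage closedin_subset topspace_eq by (metis inv_closed)

text \<open>As a union of left translates by \<open>H\<close>, the saturation is open for open
  \<open>U\<close> and, when \<open>H\<close> is finite, closed for closed \<open>U\<close>. Hence
  the projection is open, respectively closed.\<close>

lemma saturation_eq:
  assumes "subgroup H G" "U \<subseteq> carrier G"
  shows "{x \<in> topspace T. H #> x \<in> (\<lambda>x. H #> x) ` U} = (\<Union>h\<in>H. (\<lambda>u. h \<otimes> u) ` U)"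
proof -
  have "H #> x = H #> u \<longleftrightarrow> (\<exists>h\<in>H. x = h \<otimes> u)" if "x \<in> carrier G" "u \<in> carrier G" for x u
    using that assms(1) rcos_self[of x H] repr_independence[of x H u] by (auto simp: r_coset_def)
  moreover have "h \<otimes> u \<in> carrier G" if "h \<in> H" "u \<in> U" for h u
    using that assms(2) subgroup.mem_carrier[OF assms(1)] by blast
  ultimately show ?thesis
    using assms(2) unfolding topspace_eq by (auto simp: image_iff) blast+
qed

lemma open_map_coset_topology:
  assumes "subgroup H G"
  shows "open_map T (coset_topology G T H) (\<lambda>x. H #> x)"
  unfolding open_map_def coset_topology_def openin_quotient_topology
proof (intro allI impI conjI)
  fix U assume U: "openin T U"
  then have Uc: "U \<subseteq> carrier G" using openin_subset topspace_eq by blast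
  then show "(\<lambda>x. H #> x) ` U \<subseteq> (\<lambda>x. H #> x) ` topspace T" using topspace_eq by auto
  show "openin T {x \<in> topspace T. H #> x \<in> (\<lambda>x. H #> x) ` U}"
    unfolding saturation_eq[OF assms Uc]
    using U openin_left_translate subgroup.mem_carrier[OF assms] by blast
qed

lemma quotient_map_coset_topology: "quotient_map T (coset_topology G T H) (\<lambda>x. H #> x)"
  unfolding coset_topology_def by (rule quotient_map_quotient_topology)

lemma closed_map_coset_topology:
  assumes "subgroup H G" "finite H"
  shows "closed_map T (coset_topology G T H) (\<lambda>x. H #> x)"
  unfolding closed_map_def
proof (intro allI impI)
  fix U assume U: "closedin T U"
  then have Uc: "U \<subseteq> carrier G" using closedin_subset topspace_eq by blast
  have "closedin T (\<Union>h\<in>H. (\<lambda>u. h \<otimes> u) ` U)"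
    using U closedin_left_translate subgroup.mem_carrier[OF assms(1)] assms(2)
    by (intro closedin_Union) auto
  then have "closedin T {x \<in> topspace T. H #> x \<in> (\<lambda>x. H #> x) ` U}"
    by (simp only: saturation_eq[OF assms(1) Uc])
  moreover have "(\<lambda>x. H #> x) ` U \<subseteq> topspace (coset_topology G T H)"
    using Uc by (auto simp: coset_topology_def topspace_eq)
  ultimately show "closedin (coset_topology G T H) ((\<lambda>x. H #> x) ` U)"
    using quotient_map_coset_topology[of H] unfolding quotient_map_closedin by blast
qed

text \<open>A product of quotient maps need not be a quotient map, so continuity of multiplication
  comes from openness of the projection: choose representatives, take an open box around them,
  project it down. Inversion uses only the quotient property.\<close>

lemma topological_group_Mod:
  assumes H: "H \<lhd> G"
  shows "topological_group (G Mod H) (coset_topology G T H)"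
proof (intro topological_group.intro topological_group_axioms.intro)
  let ?Q = "coset_topology G T H" and ?q = "\<lambda>x. H #> x"
  have H_sub: "subgroup H G" using H by (rule normal_imp_subgroup)
  interpret q: group_hom G "G Mod H" ?q by (rule group_hom_Mod[OF H])
  note qm = quotient_map_coset_topology[of H]
  note om = open_map_coset_topology[OF H_sub]
  note cont = quotient_imp_continuous_map[OF qm]
  show "group (G Mod H)" by (rule q.H.group_axioms)
  show top: "topspace ?Q = carrier (G Mod H)"
    by (simp add: coset_topology_def topspace_eq carrier_FactGroup)
  show "continuous_map (prod_topology ?Q ?Q) ?Q (\<lambda>(x, y). x \<otimes>\<^bsub>G Mod H\<^esub> y)"
    unfolding continuous_map
  proof (intro conjI allI impI)
    show "(\<lambda>(x, y). x \<otimes>\<^bsub>G Mod H\<^esub> y) ` topspace (prod_topology ?Q ?Q) \<subseteq> topspace ?Q"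
      using q.H.m_closed by (auto simp: top simp del: mult_FactGroup)
    fix U assume U: "openin ?Q U"
    show "openin (prod_topology ?Q ?Q)
        {z \<in> topspace (prod_topology ?Q ?Q). (case z of (x, y) \<Rightarrow> x \<otimes>\<^bsub>G Mod H\<^esub> y) \<in> U}"
      unfolding openin_prod_topology_alt
    proof (intro allI impI)
      fix X Y
      assume XY: "(X, Y) \<in> {z \<in> topspace (prod_topology ?Q ?Q). (case z of (x, y) \<Rightarrow> x \<otimes>\<^bsub>G Mod H\<^esub> y) \<in> U}"
      then obtain x y where xy: "X = ?q x" "x \<in> carrier G" "Y = ?q y" "y \<in> carrier G"
        by (auto simp: top carrier_FactGroup)
      let ?P = "{x \<in> topspace T. ?q x \<in> U}"
      have "openin T ?P" using openin_continuous_map_preimage[OF cont U] .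
      from openin_continuous_map_preimage[OF continuous_mult this]
      have pre: "openin (prod_topology T T) {z \<in> topspace (prod_topology T T). (case z of (x, y) \<Rightarrow> x \<otimes> y) \<in> ?P}" .
      have mem: "(x, y) \<in> {z \<in> topspace (prod_topology T T). (case z of (x, y) \<Rightarrow> x \<otimes> y) \<in> ?P}"
        using XY xy q.hom_mult[of x y] by (simp add: topspace_eq del: mult_FactGroup)
      from pre[unfolded openin_prod_topology_alt, rule_format, OF mem]
      obtain V W where VW: "openin T V" "openin T W" "x \<in> V" "y \<in> W"
          "V \<times> W \<subseteq> {z \<in> topspace (prod_topology T T). (case z of (x, y) \<Rightarrow> x \<otimes> y) \<in> ?P}"
        by (elim exE conjE) (rule that)
      have o: "openin ?Q (?q ` V)" "openin ?Q (?q ` W)"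
        using om VW(1,2) unfolding open_map_def by blast+
      have "?q ` V \<times> ?q ` W \<subseteq>
          {z \<in> topspace (prod_topology ?Q ?Q). (case z of (x, y) \<Rightarrow> x \<otimes>\<^bsub>G Mod H\<^esub> y) \<in> U}"
      proof
        fix z assume "z \<in> ?q ` V \<times> ?q ` W"
        then obtain v w where vw: "z = (?q v, ?q w)" "v \<in> V" "w \<in> W" by blast
        then have "v \<otimes> w \<in> ?P" "v \<in> carrier G" "w \<in> carrier G"
          using VW(5) by (auto simp: topspace_eq)
        then show "z \<in>
            {z \<in> topspace (prod_topology ?Q ?Q). (case z of (x, y) \<Rightarrow> x \<otimes>\<^bsub>G Mod H\<^esub> y) \<in> U}"
          using vw(1) q.hom_mult[of v w] q.hom_closed by (simp add: top del: mult_FactGroup)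
      qed
      moreover have "X \<in> ?q ` V" "Y \<in> ?q ` W" using VW(3,4) xy by auto
      ultimately show "\<exists>V W. openin ?Q V \<and> openin ?Q W \<and> X \<in> V \<and> Y \<in> W \<and> V \<times> W \<subseteq>
          {z \<in> topspace (prod_topology ?Q ?Q). (case z of (x, y) \<Rightarrow> x \<otimes>\<^bsub>G Mod H\<^esub> y) \<in> U}"
        by (intro exI[of _ "?q ` V"] exI[of _ "?q ` W"] conjI o)
    qed
  qed
  have "continuous_map T ?Q (\<lambda>x. inv\<^bsub>G Mod H\<^esub> (?q x))"
  proof (rule continuous_map_eq[OF continuous_map_compose[OF continuous_inv cont]])
    show "(?q \<circ> (\<lambda>x. inv x)) x = inv\<^bsub>G Mod H\<^esub> (?q x)" if "x \<in> topspace T" for x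
      using that q.hom_inv by (simp add: topspace_eq)
  qed
  then show "continuous_map ?Q ?Q (\<lambda>x. inv\<^bsub>G Mod H\<^esub> x)"
    using continuous_compose_quotient_map_eq[OF qm, of ?Q "\<lambda>x. inv\<^bsub>G Mod H\<^esub> x"] by (simp add: o_def)
qed

end

context profinite_group
begin

text \<open>Finiteness of \<open>H\<close> makes the projection closed. So the quotient inherits
  normality from the compact Hausdorff space and has closed points, which gives Hausdorff.\<close>

lemma profinite_group_Mod:
  assumes H: "H \<lhd> G" and fin: "finite H"
  shows "profinite_group (G Mod H) (coset_topology G T H)"
proof (intro profinite_group.intro profinite_group_axioms.intro topological_group_Mod[OF H])
  let ?Q = "coset_topology G T H" and ?q = "\<lambda>x. H #> x"
  have H_sub: "subgroup H G" using H by (rule normal_imp_subgroup)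
  interpret q: group_hom G "G Mod H" ?q by (rule group_hom_Mod[OF H])
  note qm = quotient_map_coset_topology[of H]
  note cont = quotient_imp_continuous_map[OF qm]
  have top: "topspace ?Q = ?q ` topspace T" by (simp add: coset_topology_def)
  show "compact_space ?Q"
    using image_compactin[OF _ cont] compact unfolding compact_space_def top by blast
  have cm: "closed_map T ?Q ?q" by (rule closed_map_coset_topology[OF H_sub fin])
  have "normal_space ?Q"
    using normal_space_continuous_closed_map_image[OF _ cont cm]
      compact_Hausdorff_or_regular_imp_normal_space compact Hausdorff top by metis
  moreover have "t1_space ?Q"
    unfolding t1_space_closedin_singleton
  proof
    fix X assume "X \<in> topspace ?Q"
    then obtain x where x: "X = ?q x" "x \<in> topspace T" using top by blast
    have "closedin T {x}" using x closedin_Hausdorff_singleton[OF Hausdorff] by blast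
    then have "closedin ?Q (?q ` {x})" using cm unfolding closed_map_def by blast
    then show "closedin ?Q {X}" using x by simp
  qed
  ultimately show "Hausdorff_space ?Q" by (rule normal_t1_imp_Hausdorff_space)
  fix U assume U: "openin ?Q U" "\<one>\<^bsub>G Mod H\<^esub> \<in> U"
  have "openin T {x \<in> topspace T. ?q x \<in> U}" using openin_continuous_map_preimage[OF cont U(1)] .
  moreover have "\<one> \<in> {x \<in> topspace T. ?q x \<in> U}"
    using U(2) q.hom_one by (simp add: topspace_eq)
  ultimately obtain S where S: "subgroup S G" "openin T S" "S \<subseteq> {x \<in> topspace T. ?q x \<in> U}"
    using open_subgroup_base by blast
  have "openin ?Q (?q ` S)"
    using open_map_coset_topology[OF H_sub] S(2) unfolding open_map_def by blast
  then show "\<exists>S. subgroup S (G Mod H) \<and> openin ?Q S \<and> S \<subseteq> U"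
    using q.subgroup_img_is_subgroup[OF S(1)] S(3) by blast
qed

end

context pro_p_group
begin

lemma pro_p_group_Mod:
  assumes H: "H \<lhd> G" and fin: "finite H"
  shows "pro_p_group (G Mod H) (coset_topology G T H) p"
proof (intro pro_p_group.intro pro_p_group_axioms.intro profinite_group_Mod[OF H fin])
  fix N assume N: "N \<lhd> G Mod H" "openin (coset_topology G T H) N"
  let ?S = "{x \<in> carrier G. H #> x \<in> N}"
  interpret q: group_hom G "G Mod H" "\<lambda>x. H #> x" by (rule group_hom_Mod[OF H])
  have N_sub: "subgroup N (G Mod H)" using N(1) by (rule normal_imp_subgroup)
  note card = card_rcosets_Mod[OF H N_sub]
  have "x \<otimes> s \<otimes> inv x \<in> ?S" if "x \<in> carrier G" "s \<in> ?S" for x s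
  proof -
    have "(H #> x) \<otimes>\<^bsub>G Mod H\<^esub> (H #> s) \<otimes>\<^bsub>G Mod H\<^esub> inv\<^bsub>G Mod H\<^esub> (H #> x) \<in> N"
      using that q.hom_closed by (intro q.H.normal_conj N(1)) auto
    also have "(H #> x) \<otimes>\<^bsub>G Mod H\<^esub> (H #> s) \<otimes>\<^bsub>G Mod H\<^esub> inv\<^bsub>G Mod H\<^esub> (H #> x) = H #> (x \<otimes> s \<otimes> inv x)"
      using that q.hom_mult q.hom_inv by (simp del: mult_FactGroup)
    finally show ?thesis using that by simp
  qed
  then have "?S \<lhd> G" using card(1) by (simp add: normal_inv_iff)
  moreover have "openin T ?S"
    using openin_continuous_map_preimage[OF quotient_imp_continuous_map[OF quotient_map_coset_topology] N(2)]
    by (simp add: topspace_eq)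
  ultimately show "\<exists>n. card (rcosets\<^bsub>G Mod H\<^esub> N) = p ^ n"
    using open_normal_index card(2) by metis
qed

text \<open>The class equation: orbits in \<open>F\<close> under conjugation have size dividing a
  power of \<open>p\<close>, so if \<open>\<one>\<close> were the only fixed point,
  \<open>card F\<close> would be 1 modulo \<open>p\<close>.\<close>

lemma exists_central_in_finite_normal:
  assumes p: "prime p" and F: "F \<lhd> G" and fin: "finite F" and dvd: "p dvd card F"
  shows "\<exists>f\<in>F. f \<noteq> \<one> \<and> (\<forall>g\<in>carrier G. com G f g = \<one>)"
proof (rule ccontr)
  assume contr: "\<not> ?thesis"
  define \<phi> where "\<phi> = (\<lambda>g. \<lambda>h\<in>carrier G. g \<otimes> h \<otimes> inv g)"
  interpret A: group_action G "carrier G" \<phi>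
    unfolding \<phi>_def by (rule action_by_conjugation)
  have F_sub: "subgroup F G" using F by (rule normal_imp_subgroup)
  have Fc: "F \<subseteq> carrier G" using subgroup.subset[OF F_sub] .
  let ?O = "orbit G \<phi>" and ?S = "stabilizer G \<phi>"
  have orb: "?O f = {g \<otimes> f \<otimes> inv g | g. g \<in> carrier G}" if "f \<in> F" for f
    using that Fc by (auto simp: orbit_def \<phi>_def)
  have orbF: "?O f \<subseteq> F" if "f \<in> F" for f
    using that normal_conj[OF F] orb by auto
  have stab_open: "openin T (?S f)" if f: "f \<in> F" for f
  proof -
    \<comment> \<open>Conjugates of \<open>f\<close> stay in \<open>F\<close>, so the stabiliser is
      the preimage of the complement of the finite, hence closed, set
      \<open>F - {f}\<close>.\<close>
    have "closedin T (F - {f})"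
      using Fc fin by (intro closedin_Hausdorff_finite Hausdorff) (auto simp: topspace_eq)
    then have "openin T (topspace T - (F - {f}))" by blast
    from openin_continuous_map_preimage[OF continuous_conj this]
    have "openin T {g \<in> topspace T. g \<otimes> f \<otimes> inv g \<in> topspace T - (F - {f})}"
      using f Fc by blast
    also have "{g \<in> topspace T. g \<otimes> f \<otimes> inv g \<in> topspace T - (F - {f})} = ?S f"
      using f Fc normal_conj[OF F] unfolding stabilizer_def \<phi>_def topspace_eq by auto
    finally show ?thesis .
  qed
  \<comment> \<open>Stabilisers need not be normal, but their intersection \<open>C\<close>, the
    centraliser of \<open>F\<close>, is. \<open>open_normal_index\<close> applies to
    \<open>C\<close>, and every orbit size divides its index.\<close>
  define C where "C = (\<Inter>f\<in>F. ?S f)"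
  have ne: "F \<noteq> {}" using subgroup.one_closed[OF F_sub] by blast
  have C_eq: "C = {c \<in> carrier G. \<forall>f\<in>F. c \<otimes> f \<otimes> inv c = f}"
    using ne Fc unfolding C_def stabilizer_def \<phi>_def by auto
  have "openin T C" unfolding C_def using fin ne stab_open by (intro openin_INT2) auto
  moreover have "C \<lhd> G"
  proof -
    have "subgroup C G" unfolding C_def
      using ne Fc A.stabilizer_subgroup by (intro subgroups_Inter) auto
    moreover have "x \<otimes> c \<otimes> inv x \<in> C" if x: "x \<in> carrier G" and c: "c \<in> C" for x c
    proof -
      have cc: "c \<in> carrier G" using c C_eq by blast
      have "(x \<otimes> c \<otimes> inv x) \<otimes> f \<otimes> inv (x \<otimes> c \<otimes> inv x) = f" if f: "f \<in> F" for f
      proof -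
        have fc: "f \<in> carrier G" using f Fc by blast
        have "inv x \<otimes> f \<otimes> inv (inv x) \<in> F" using normal_conj[OF F _ f] x by blast
        then have "c \<otimes> (inv x \<otimes> f \<otimes> x) \<otimes> inv c = inv x \<otimes> f \<otimes> x" using c x C_eq by auto
        then have "x \<otimes> (c \<otimes> (inv x \<otimes> f \<otimes> x) \<otimes> inv c) \<otimes> inv x = f"
          using x fc by (simp add: m_assoc)
        then show ?thesis using x cc fc by (simp add: m_assoc inv_mult_group)
      qed
      then show ?thesis using x cc C_eq by auto
    qed
    ultimately show ?thesis by (simp add: normal_inv_iff)
  qed
  ultimately obtain n where n: "card (rcosets C) = p ^ n"
    using open_normal_index by blast
  have card_orb: "card (?O f) dvd p ^ n" if f: "f \<in> F" for f
  proof -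
    have fc: "f \<in> carrier G" using f Fc by blast
    have "card (rcosets (?S f)) = card (?O f)"
      using bij_betw_same_card[OF A.orbit_stab_fun_is_bij[OF fc]] .
    moreover have "card (rcosets (?S f)) dvd card (rcosets C)"
      using A.stabilizer_subgroup[OF fc] f by (intro card_rcosets_dvd \<open>C \<lhd> G\<close>) (auto simp: C_def)
    ultimately show ?thesis using n by simp
  qed
  have dvd_orb: "p dvd card (?O f)" if f: "f \<in> F" "f \<noteq> \<one>" for f
  proof (rule ccontr)
    assume "\<not> p dvd card (?O f)"
    then have "card (?O f) = 1"
      using card_orb[OF f(1)] p by (metis divides_primepow_nat dvd_triv_left power_0 power_Suc not0_implies_Suc)
    then obtain z where z: "?O f = {z}" using card_1_singletonE by blast
    have "g \<otimes> f \<otimes> inv g = f" if "g \<in> carrier G" for g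
    proof -
      have "f \<in> ?O f" using A.orbit_refl f Fc by blast
      moreover have "g \<otimes> f \<otimes> inv g \<in> ?O f" using orb[OF f(1)] that by blast
      ultimately show ?thesis using z by simp
    qed
    then have "com G f g = \<one>" if "g \<in> carrier G" for g
    proof -
      have fc: "f \<in> carrier G" using f Fc by blast
      have "inv (com G f g) = (g \<otimes> f \<otimes> inv g) \<otimes> inv f"
        using that fc by (simp add: group_word_simps)
      also have "\<dots> = \<one>" using that fc \<open>g \<in> carrier G \<Longrightarrow> g \<otimes> f \<otimes> inv g = f\<close> by simp
      finally show ?thesis using that fc by (metis com_closed inv_inv inv_one)
    qed
    then show False using contr f by blast
  qed
  have orb1: "?O \<one> = {\<one>}"
  proof
    show "?O \<one> \<subseteq> {\<one>}"
    proof
      fix y assume "y \<in> ?O \<one>"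
      then obtain g where "g \<in> carrier G" "y = g \<otimes> \<one> \<otimes> inv g"
        unfolding orb[OF subgroup.one_closed[OF F_sub]] by blast
      then show "y \<in> {\<one>}" by simp
    qed
    show "{\<one>} \<subseteq> ?O \<one>" using A.orbit_refl[OF one_closed] by blast
  qed
  let ?Os = "?O ` F"
  have "F = \<Union>?Os"
    using orbF A.orbit_refl Fc by blast
  moreover have "card (\<Union>?Os) = sum card ?Os"
  proof (rule card_Union_disjoint)
    show "pairwise disjnt ?Os"
      unfolding pairwise_def disjnt_def
      using A.disjoint_union Fc by (auto simp: orbits_def)
    show "finite A" if "A \<in> ?Os" for A
      using that orbF fin finite_subset by blast
  qed
  moreover have "sum card ?Os = card {\<one>} + sum card (?Os - {{\<one>}})"
    using fin orb1 subgroup.one_closed[OF F_sub] sum.remove[of ?Os "{\<one>}" card] by (metis finite_imageI imageI)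
  moreover have "p dvd sum card (?Os - {{\<one>}})"
    using dvd_orb orb1 by (intro dvd_sum) auto
  ultimately have "p dvd card F" "card F = 1 + sum card (?Os - {{\<one>}})"
    using dvd by simp_all
  then have "p dvd 1" using \<open>p dvd sum card (?Os - {{\<one>}})\<close> by (metis dvd_add_left_iff)
  then show False using p by (simp add: not_prime_unit)
qed

text \<open>A nontrivial central element of \<open>F\<close> modulo its part in the upper term
  \<open>j\<close> lifts to an element of \<open>F\<close> that is new in term \<open>Suc j\<close>.
  So the intersections grow strictly until they exhaust \<open>F\<close>.\<close>

lemma finite_normal_subset_rel_ucs:
  assumes p: "prime p" and F: "F \<lhd> G" and card_F: "card F = p ^ n"
  shows "\<exists>N. F \<subseteq> rel_ucs G {\<one>} N"
proof -
  have F_sub: "subgroup F G" using F by (rule normal_imp_subgroup)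
  have fin: "finite F" using card_F p by (metis card.infinite power_eq_0_iff not_prime_0)
  let ?Z = "\<lambda>j. rel_ucs G {\<one>} j"
  have ex: "\<exists>f\<in>F \<inter> ?Z (Suc j). f \<notin> ?Z j" if notsub: "\<not> F \<subseteq> ?Z j" for j
  proof -
    \<comment> \<open>Dividing by the intersection with \<open>F\<close> rather than by
      \<open>?Z j\<close> keeps the subgroup finite, as \<open>pro_p_group_Mod\<close>
      requires.\<close>
    define A where "A = F \<inter> ?Z j"
    have A: "A \<lhd> G"
      unfolding A_def by (intro normal_subgroup_intersect F rel_ucs_normal[OF one_is_normal])
    have A_sub: "subgroup A G" using A by (rule normal_imp_subgroup)
    have A_fin: "finite A" using fin by (simp add: A_def)
    interpret Q: pro_p_group "G Mod A" "coset_topology G T A" p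
      by (rule pro_p_group_Mod[OF A A_fin])
    interpret q: group_hom G "G Mod A" "\<lambda>x. A #> x" by (rule group_hom_Mod[OF A])
    let ?F = "(\<lambda>x. A #> x) ` F"
    have "?F \<lhd> G Mod A"
      unfolding Q.normal_inv_iff
    proof (intro conjI ballI)
      show "subgroup ?F (G Mod A)" by (rule q.subgroup_img_is_subgroup[OF F_sub])
      fix X Y assume "X \<in> carrier (G Mod A)" "Y \<in> ?F"
      then obtain x f where xf: "X = A #> x" "x \<in> carrier G" "Y = A #> f" "f \<in> F"
        by (auto simp: carrier_FactGroup)
      have "f \<in> carrier G" using xf subgroup.mem_carrier[OF F_sub] by blast
      then have "X \<otimes>\<^bsub>G Mod A\<^esub> Y \<otimes>\<^bsub>G Mod A\<^esub> inv\<^bsub>G Mod A\<^esub> X = A #> (x \<otimes> f \<otimes> inv x)"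
        using xf q.hom_mult q.hom_inv by (simp del: mult_FactGroup)
      then show "X \<otimes>\<^bsub>G Mod A\<^esub> Y \<otimes>\<^bsub>G Mod A\<^esub> inv\<^bsub>G Mod A\<^esub> X \<in> ?F"
        using normal_conj[OF F] xf by auto
    qed
    moreover have "p dvd card ?F"
    proof -
      interpret GF: group "G\<lparr>carrier := F\<rparr>"
        using F_sub by (rule subgroup.subgroup_is_group) (rule group_axioms)
      have "subgroup A (G\<lparr>carrier := F\<rparr>)"
        using A_sub F_sub by (intro subgroup_incl) (auto simp: A_def)
      from GF.lagrange[OF this] have "card ?F * card A = p ^ n"
        by (simp add: order_def card_F GF.rcosets_eq_image)
      moreover have "card A < p ^ n"
        unfolding card_F[symmetric] using notsub fin by (intro psubset_card_mono) (auto simp: A_def)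
      ultimately have "card ?F dvd p ^ n" "card ?F \<noteq> 1" by (auto intro: dvdI[of _ _ "card A"])
      then show ?thesis
        using p by (metis divides_primepow_nat dvd_triv_left power_0 power_Suc not0_implies_Suc)
    qed
    ultimately obtain X where X: "X \<in> ?F" "X \<noteq> \<one>\<^bsub>G Mod A\<^esub>"
        "\<forall>Y\<in>carrier (G Mod A). com (G Mod A) X Y = \<one>\<^bsub>G Mod A\<^esub>"
      using Q.exists_central_in_finite_normal[OF p] fin by blast
    then obtain f where f: "X = A #> f" "f \<in> F" by blast
    have fc: "f \<in> carrier G" using f subgroup.mem_carrier[OF F_sub] by blast
    have "f \<notin> A" using X(2) f rcos_eq_self_iff[OF A_sub fc] by simp
    moreover have "com G f g \<in> A" if g: "g \<in> carrier G" for g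
    proof -
      have "A #> com G f g = com (G Mod A) X (A #> g)"
        using fc g f q.hom_mult q.hom_inv by (simp add: com_def del: mult_FactGroup)
      also have "\<dots> = A" using X(3) g q.hom_closed by simp
      finally show ?thesis using rcos_eq_self_iff[OF A_sub, of "com G f g"] fc g by simp
    qed
    ultimately show ?thesis using f fc by (auto simp: A_def)
  qed
  \<comment> \<open>Each strict growth adds at least one element, so for \<open>j\<close> beyond
    \<open>card F\<close> only the first alternative remains.\<close>
  have "F \<subseteq> ?Z j \<or> j \<le> card (F \<inter> ?Z j)" for j
  proof (induction j)
    case (Suc j)
    have mono: "?Z j \<subseteq> ?Z (Suc j)" by (rule rel_ucs_antimono[OF one_is_normal]) simp
    show ?case
    proof (cases "F \<subseteq> ?Z j")
      case True
      then show ?thesis using mono by blast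
    next
      case False
      then have "card (F \<inter> ?Z j) < card (F \<inter> ?Z (Suc j))"
        using ex[OF False] mono fin by (intro psubset_card_mono) auto
      then show ?thesis using Suc False by auto
    qed
  qed auto
  from this[of "Suc (card F)"] have "F \<subseteq> ?Z (Suc (card F))"
    using card_mono[OF fin, of "F \<inter> ?Z (Suc (card F))"] by auto
  then show ?thesis by blast
qed

text \<open>Finite sets are closed in a Hausdorff space, so neither generation nor closure adds
  anything.\<close>

lemma Omega_eq_if_subgroup:
  assumes "subgroup {x \<in> carrier G. x [^] (p ^ j) = \<one>} G" "finite {x \<in> carrier G. x [^] (p ^ j) = \<one>}"
  shows "Omega G T p j = {x \<in> carrier G. x [^] (p ^ j) = \<one>}"
proof -
  have "generate G {x \<in> carrier G. x [^] (p ^ j) = \<one>} = {x \<in> carrier G. x [^] (p ^ j) = \<one>}"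
    using generate_subgroup_incl[OF subset_refl assms(1)] by (auto intro: generate.incl)
  moreover have "closedin T {x \<in> carrier G. x [^] (p ^ j) = \<one>}"
    using assms(2) by (intro closedin_Hausdorff_finite Hausdorff) (auto simp: topspace_eq)
  ultimately show ?thesis unfolding Omega_def by (simp add: closure_of_closedin)
qed

end

theorem theoremB:
  fixes P :: "('a, 'b) monoid_scheme" and T :: "'a topology" and p k i :: nat
  assumes "prime p"
    and "k \<ge> 1" and "i \<ge> 1"
    and "k \<le> p - 2 \<or> (k = p - 1 \<and> i \<ge> 2)"
    and "pro_p_group P T p"
    and "p_power_central P T p i k"
    and "finite_p_subgroup P p (torsion_elements P)"
  shows "\<forall>j\<ge>1.
      pro_p_group (P Mod Omega P T p j) (coset_topology P T (Omega P T p j)) p \<and>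
      p_power_central (P Mod Omega P T p j) (coset_topology P T (Omega P T p j)) p i k \<and>
      Omega P T p j = {x \<in> carrier P. x [^]\<^bsub>P\<^esub> (p ^ j) = \<one>\<^bsub>P\<^esub>}"
proof (intro allI impI)
  fix j :: nat
  interpret P: pro_p_group P T p by fact
  define F where "F j = {x \<in> carrier P. x [^]\<^bsub>P\<^esub> (p ^ j) = \<one>\<^bsub>P\<^esub>}" for j
  let ?T = "torsion_elements P"
  from assms(7) obtain n where T: "subgroup ?T P" "finite ?T" "card ?T = p ^ n"
    unfolding finite_p_subgroup_def by blast
  have FT: "F j \<subseteq> ?T" for j
    using prime_gt_0_nat[OF assms(1)] by (auto simp: F_def torsion_elements_def intro: exI[of _ "p ^ j"])
  have F_fin: "finite (F j)" for j using FT T(2) finite_subset by blast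
  have "?T \<lhd> P"
    unfolding P.normal_inv_iff
  proof (intro conjI ballI T(1))
    fix x h assume "x \<in> carrier P" "h \<in> ?T"
    then show "x \<otimes>\<^bsub>P\<^esub> h \<otimes>\<^bsub>P\<^esub> inv\<^bsub>P\<^esub> x \<in> ?T"
      by (auto simp: torsion_elements_def P.conj_nat_pow)
  qed
  then obtain N where N: "?T \<subseteq> rel_ucs P {\<one>\<^bsub>P\<^esub>} N"
    using P.finite_normal_subset_rel_ucs[OF assms(1) _ T(3)] by blast
  have "F i \<subseteq> Omega P T p i"
  proof -
    have "F i \<subseteq> generate P (F i)" by (auto intro: generate.incl)
    also have "\<dots> \<subseteq> T closure_of generate P (F i)"
      unfolding P.topspace_eq[symmetric]
      using P.generate_incl[of "F i"] by (intro closure_of_subset) (auto simp: F_def P.topspace_eq)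
    finally show ?thesis by (simp add: Omega_def F_def)
  qed
  then have hk: "x \<in> rel_ucs P {\<one>\<^bsub>P\<^esub>} k" if "x \<in> carrier P" "x [^]\<^bsub>P\<^esub> (p ^ i) = \<one>\<^bsub>P\<^esub>" for x
    using that assms(6) unfolding p_power_central_def P.upper_central_series_eq_rel_ucs F_def by blast
  have hN: "x \<in> rel_ucs P {\<one>\<^bsub>P\<^esub>} N" if "x \<in> carrier P" "x [^]\<^bsub>P\<^esub> (p ^ j) = \<one>\<^bsub>P\<^esub>" for x j
    using that N FT[of j] unfolding F_def by blast
  note roots = P.p_power_roots_normal[OF assms(1-4) hk hN, folded F_def]
  have F: "F j \<lhd> P" for j by (rule roots(1))
  have F_sub: "subgroup (F j) P" for j using F by (rule normal_imp_subgroup)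
  have Om: "Omega P T p j = F j"
    unfolding F_def by (rule P.Omega_eq_if_subgroup) (use F_sub F_fin in \<open>auto simp: F_def\<close>)
  interpret Q: pro_p_group "P Mod F j" "coset_topology P T (F j)" p
    by (rule P.pro_p_group_Mod[OF F F_fin])
  interpret q: group_hom P "P Mod F j" "\<lambda>x. F j #>\<^bsub>P\<^esub> x" by (rule P.group_hom_Mod[OF F])
  let ?R = "{X \<in> carrier (P Mod F j). X [^]\<^bsub>P Mod F j\<^esub> (p ^ i) = \<one>\<^bsub>P Mod F j\<^esub>}"
  \<comment> \<open>The elements of the quotient killed by \<open>p ^ i\<close> come from
    \<open>F (i + j)\<close>. They form a finite subgroup, so \<open>Omega_eq_if_subgroup\<close>
    applies in the quotient as well.\<close>
  have "F j #>\<^bsub>P\<^esub> x \<in> ?R \<longleftrightarrow> x \<in> F (i + j)" if "x \<in> carrier P" for x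
  proof -
    have "(F j #>\<^bsub>P\<^esub> x) [^]\<^bsub>P Mod F j\<^esub> (p ^ i) = F j #>\<^bsub>P\<^esub> (x [^]\<^bsub>P\<^esub> (p ^ i))"
      using that by (simp add: q.hom_nat_pow)
    also have "\<dots> = F j \<longleftrightarrow> x [^]\<^bsub>P\<^esub> (p ^ i) \<in> F j"
      using that by (intro P.rcos_eq_self_iff F_sub) simp
    also have "\<dots> \<longleftrightarrow> x \<in> F (i + j)"
      using that by (simp add: F_def P.nat_pow_pow power_add)
    finally show ?thesis using that q.hom_closed by simp
  qed
  then have R: "?R = (\<lambda>x. F j #>\<^bsub>P\<^esub> x) ` F (i + j)"
    by (auto simp: carrier_FactGroup F_def)
  have "subgroup ?R (P Mod F j)" "finite ?R"
    unfolding R by (intro q.subgroup_img_is_subgroup F_sub finite_imageI F_fin)+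
  then have "Omega (P Mod F j) (coset_topology P T (F j)) p i = ?R"
    by (rule Q.Omega_eq_if_subgroup)
  moreover have "?R \<subseteq> upper_central_series (P Mod F j) k"
    unfolding R Q.upper_central_series_eq_rel_ucs
    using roots(2)[where j = j] P.rel_ucs_Mod[OF F] by (auto simp: F_def)
  ultimately show "pro_p_group (P Mod Omega P T p j) (coset_topology P T (Omega P T p j)) p \<and>
      p_power_central (P Mod Omega P T p j) (coset_topology P T (Omega P T p j)) p i k \<and>
      Omega P T p j = {x \<in> carrier P. x [^]\<^bsub>P\<^esub> (p ^ j) = \<one>\<^bsub>P\<^esub>}"
    unfolding Om p_power_central_def using Q.pro_p_group_axioms by (simp add: F_def)
qed

end
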